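(* Let $R$ be a commutative ring, $n\ge2$, $t\ge1$, and let $\varphi$ be a $2n\times2n$ alternating matrix over $R$ with Pfaffian $1$. Let $\theta(X_1,\dots,X_t)\in{\rm SL}_{2n-1}(R[X_1,\dots,X_t])$ with $\theta(0,\dots,0)=I_{2n-1}$. If for every maximal ideal $\mathfrak m$ of $R$ the image of $\theta$ over $R_{\mathfrak m}[X_1,\dots,X_t]$ lies in ${\rm E}_{\varphi\otimes R_{\mathfrak m}[X_1,\dots,X_t]}(R_{\mathfrak m}[X_1,\dots,X_t])$, then $\theta(X_1,\dots,X_t)\in{\rm E}_{\varphi\otimes R[X_1,\dots,X_t]}(R[X_1,\dots,X_t])$.
   Context: All rings are commutative with identity; $R_{\mathfrak m}$ is the localisation at $\mathfrak m$. A square matrix is alternating if it is of the form $\nu-\nu^t$; alternating matrices of Pfaffian $1$ are invertible. Elements of $S^m$ are row vectors, ${}^t$ is transpose. For an invertible alternating $2n\times2n$ matrix $\varphi$ over a ring $S$ write $\varphi=\begin{pmatrix}0&-c\\ c^t&\nu\end{pmatrix}$, $\varphi^{-1}=\begin{pmatrix}0&d\\ -d^t&\mu\end{pmatrix}$ with $c,d\in S^{2n-1}$, and set $\alpha_\varphi(v)=I_{2n-1}+d^tv\nu$, $\beta_\varphi(v)=I_{2n-1}+\mu v^tc$ for $v\in S^{2n-1}$; ${\rm E}_\varphi(S)$ is the subgroup of ${\rm GL}_{2n-1}(S)$ generated by all these. For a ring homomorphism $R\to S$, ${\rm E}_{\varphi\otimes S}(S)$ denotes ${\rm E}_{\varphi'}(S)$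 where $\varphi'$ is the image of $\varphi$ over $S$. *)

theory Defs
  imports "Jordan_Normal_Form.Determinant" "HOL-Library.Poly_Mapping"
begin

definition alternating_mat :: "'a::comm_ring_1 mat \<Rightarrow> bool" where
  "alternating_mat A \<longleftrightarrow> (\<exists>\<nu>. \<nu> \<in> carrier_mat (dim_row A) (dim_col A) \<and> A = \<nu> - transpose_mat \<nu>)"

text \<open>Pfaffian of a 2k x 2k matrix (indices 0..2k-1): sum over permutations
  sigma with sigma(2i) < sigma(2i+1) and sigma(0) < sigma(2) < ... (perfect matchings).\<close>
definition pfaffian :: "'a::comm_ring_1 mat \<Rightarrow> 'a" where
  "pfaffian A = (let k = dim_row A div 2 in
     \<Sum>\<sigma> \<in> {\<sigma>. \<sigma> permutes {..<2*k} \<and> (\<forall>i<k. \<sigma> (2*i) < \<sigma> (2*i+1))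
                 \<and> (\<forall>i. i + 1 < k \<longrightarrow> \<sigma> (2*i) < \<sigma> (2*i+2))}.
        of_int (sign \<sigma>) * (\<Prod>i<k. A $$ (\<sigma> (2*i), \<sigma> (2*i+1))))"

definition mat_inverse :: "'a::comm_ring_1 mat \<Rightarrow> 'a mat" where
  "mat_inverse A = (SOME B. B \<in> carrier_mat (dim_row A) (dim_row A) \<and>
       A * B = 1\<^sub>m (dim_row A) \<and> B * A = 1\<^sub>m (dim_row A))"

text \<open>phi = [[0,-c],[c^t,nu]], phi^-1 = [[0,d],[-d^t,mu]]; c,d are rows of length 2n-1.\<close>
definition blk_c :: "'a::comm_ring_1 mat \<Rightarrow> 'a vec" where
  "blk_c \<phi> = vec (dim_row \<phi> - 1) (\<lambda>j. - \<phi> $$ (0, j+1))"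
definition blk_nu :: "'a::comm_ring_1 mat \<Rightarrow> 'a mat" where
  "blk_nu \<phi> = mat (dim_row \<phi> - 1) (dim_row \<phi> - 1) (\<lambda>(i,j). \<phi> $$ (i+1, j+1))"
definition blk_d :: "'a::comm_ring_1 mat \<Rightarrow> 'a vec" where
  "blk_d \<phi> = vec (dim_row \<phi> - 1) (\<lambda>j. mat_inverse \<phi> $$ (0, j+1))"
definition blk_mu :: "'a::comm_ring_1 mat \<Rightarrow> 'a mat" where
  "blk_mu \<phi> = mat (dim_row \<phi> - 1) (dim_row \<phi> - 1) (\<lambda>(i,j). mat_inverse \<phi> $$ (i+1, j+1))"

text \<open>d^t v nu and mu v^t c, as (2n-1) x (2n-1) matrices (v a row vector).\<close>
definition alpha_part :: "'a::comm_ring_1 mat \<Rightarrow> 'a vec \<Rightarrow> 'a mat" where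
  "alpha_part \<phi> v = (let k = dim_row \<phi> - 1 in
     mat k k (\<lambda>(i,j). blk_d \<phi> $ i * ((transpose_mat (blk_nu \<phi>)) *\<^sub>v v) $ j))"
definition beta_part :: "'a::comm_ring_1 mat \<Rightarrow> 'a vec \<Rightarrow> 'a mat" where
  "beta_part \<phi> v = (let k = dim_row \<phi> - 1 in
     mat k k (\<lambda>(i,j). (blk_mu \<phi> *\<^sub>v v) $ i * blk_c \<phi> $ j))"

definition alpha_gen :: "'a::comm_ring_1 mat \<Rightarrow> 'a vec \<Rightarrow> 'a mat" where
  "alpha_gen \<phi> v = 1\<^sub>m (dim_row \<phi> - 1) + alpha_part \<phi> v"
definition beta_gen :: "'a::comm_ring_1 mat \<Rightarrow> 'a vec \<Rightarrow> 'a mat" where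
  "beta_gen \<phi> v = 1\<^sub>m (dim_row \<phi> - 1) + beta_part \<phi> v"

section \<open>The group E_phi(S) for a subring S (given as a carrier set C of a ring type)\<close>

definition mat_over :: "'a set \<Rightarrow> nat \<Rightarrow> 'a mat set" where
  "mat_over C k = {M \<in> carrier_mat k k. \<forall>i<k. \<forall>j<k. M $$ (i,j) \<in> C}"
definition vec_over :: "'a set \<Rightarrow> nat \<Rightarrow> 'a vec set" where
  "vec_over C k = {v \<in> carrier_vec k. \<forall>i<k. v $ i \<in> C}"

inductive_set E_phi :: "'a::comm_ring_1 set \<Rightarrow> 'a mat \<Rightarrow> 'a mat set" for C \<phi> where
  E_one: "1\<^sub>m (dim_row \<phi> - 1) \<in> E_phi C \<phi>"
| E_alpha: "v \<in> vec_over C (dim_row \<phi> - 1) \<Longrightarrow> alpha_gen \<phi> v \<in> E_phi C \<phi>"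
| E_beta: "v \<in> vec_over C (dim_row \<phi> - 1) \<Longrightarrow> beta_gen \<phi> v \<in> E_phi C \<phi>"
| E_mult: "g \<in> E_phi C \<phi> \<Longrightarrow> h \<in> E_phi C \<phi> \<Longrightarrow> g * h \<in> E_phi C \<phi>"
| E_inv: "g \<in> E_phi C \<phi> \<Longrightarrow> h \<in> carrier_mat (dim_row \<phi> - 1) (dim_row \<phi> - 1) \<Longrightarrow>
          g * h = 1\<^sub>m (dim_row \<phi> - 1) \<Longrightarrow> h * g = 1\<^sub>m (dim_row \<phi> - 1) \<Longrightarrow> h \<in> E_phi C \<phi>"

text \<open>Polynomials in variables indexed by nat; X_1..X_t are the variables 0..t-1.\<close>
type_synonym 'a mpoly = "(nat \<Rightarrow>\<^sub>0 nat) \<Rightarrow>\<^sub>0 'a"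

definition cst :: "'a::comm_ring_1 \<Rightarrow> 'a mpoly" where
  "cst a = Poly_Mapping.single 0 a"

definition polys_in :: "nat \<Rightarrow> 'a::comm_ring_1 mpoly set" where
  "polys_in t = {p. \<forall>mon \<in> Poly_Mapping.keys p. \<forall>j \<in> Poly_Mapping.keys (mon :: nat \<Rightarrow>\<^sub>0 nat). j < t}"

definition eval_zero :: "'a::comm_ring_1 mpoly mat \<Rightarrow> 'a mat" where
  "eval_zero M = map_mat (\<lambda>p. Poly_Mapping.lookup p 0) M"

definition is_ideal :: "'a::comm_ring_1 set \<Rightarrow> bool" where
  "is_ideal I \<longleftrightarrow> 0 \<in> I \<and> (\<forall>x\<in>I. \<forall>y\<in>I. x + y \<in> I) \<and> (\<forall>r x. x \<in> I \<longrightarrow> r * x \<in> I)"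

definition maximal_ideal :: "'a::comm_ring_1 set \<Rightarrow> bool" where
  "maximal_ideal m \<longleftrightarrow> is_ideal m \<and> m \<noteq> UNIV \<and>
     (\<forall>J. is_ideal J \<and> m \<subseteq> J \<longrightarrow> J = m \<or> J = UNIV)"

text \<open>R_m[X_1..X_t] is realised as the localisation of R[X_1..X_t] at the constants
  from R - m. A square matrix over it is represented by a pair (M, s) meaning M/s,
  with M a matrix over R[X_1..X_t] and s in R - m; (M,s) and (N,u) represent the same
  matrix iff v (u M - s N) = 0 for some v in R - m.\<close>
definition loc_eq :: "'a::comm_ring_1 set \<Rightarrow> 'a mpoly mat \<times> 'a \<Rightarrow> 'a mpoly mat \<times> 'a \<Rightarrow> bool" where
  "loc_eq m A B = (case A of (M, s) \<Rightarrow> case B of (N, u) \<Rightarrow>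
     \<exists>v. v \<notin> m \<and> cst v \<cdot>\<^sub>m (cst u \<cdot>\<^sub>m M - cst s \<cdot>\<^sub>m N) = 0\<^sub>m (dim_row M) (dim_col M))"

definition loc_mat :: "nat \<Rightarrow> 'a::comm_ring_1 set \<Rightarrow> nat \<Rightarrow> ('a mpoly mat \<times> 'a) set" where
  "loc_mat t m k = {(M, s). M \<in> mat_over (polys_in t) k \<and> s \<notin> m}"

text \<open>E_{phi tensor R_m[X]}(R_m[X]) as a set of representatives: the subgroup of
  GL_{2n-1}(R_m[X]) generated by alpha(w/s), beta(w/s), w in R[X]^{2n-1}, s in R - m.
  Here phi is the image over R[X]; its image over R_m[X] is phi/1, and
  alpha(w/s) = (s I + d^t w nu)/s, beta(w/s) = (s I + mu w^t c)/s.\<close>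
inductive_set E_loc :: "nat \<Rightarrow> 'a::comm_ring_1 set \<Rightarrow> 'a mpoly mat \<Rightarrow> ('a mpoly mat \<times> 'a) set"
  for t m \<phi> where
  L_alpha: "w \<in> vec_over (polys_in t) (dim_row \<phi> - 1) \<Longrightarrow> s \<notin> m \<Longrightarrow>
     (cst s \<cdot>\<^sub>m 1\<^sub>m (dim_row \<phi> - 1) + alpha_part \<phi> w, s) \<in> E_loc t m \<phi>"
| L_beta: "w \<in> vec_over (polys_in t) (dim_row \<phi> - 1) \<Longrightarrow> s \<notin> m \<Longrightarrow>
     (cst s \<cdot>\<^sub>m 1\<^sub>m (dim_row \<phi> - 1) + beta_part \<phi> w, s) \<in> E_loc t m \<phi>"
| L_one: "(1\<^sub>m (dim_row \<phi> - 1), 1) \<in> E_loc t m \<phi>"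
| L_mult: "(M, s) \<in> E_loc t m \<phi> \<Longrightarrow> (N, u) \<in> E_loc t m \<phi> \<Longrightarrow> (M * N, s * u) \<in> E_loc t m \<phi>"
| L_inv: "(M, s) \<in> E_loc t m \<phi> \<Longrightarrow> (N, u) \<in> loc_mat t m (dim_row \<phi> - 1) \<Longrightarrow>
     loc_eq m (M * N, s * u) (1\<^sub>m (dim_row \<phi> - 1), 1) \<Longrightarrow>
     loc_eq m (N * M, u * s) (1\<^sub>m (dim_row \<phi> - 1), 1) \<Longrightarrow> (N, u) \<in> E_loc t m \<phi>"
| L_eq: "(M, s) \<in> E_loc t m \<phi> \<Longrightarrow> (N, u) \<in> loc_mat t m (dim_row \<phi> - 1) \<Longrightarrow>
     loc_eq m (M, s) (N, u) \<Longrightarrow> (N, u) \<in> E_loc t m \<phi>"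

end

theory Submission
  imports Defs
begin

text \<open>
  Both kinds of generators are transvections \<open>I + u v\<close> (a column times a row, with \<open>v u = 0\<close>):
  the \<open>\<alpha>\<close>'s are the \<open>I + d\<^sup>t f\<close> with \<open>f d\<^sup>t = 0\<close>, the \<open>\<beta>\<close>'s are the \<open>I + y c\<close> with \<open>c y = 0\<close>,
  and \<open>c d\<^sup>t = 1\<close>. Where an entry of \<open>c\<close> is inverted, the complement of \<open>d\<^sup>t\<close> becomes free of rank
  \<open>2n - 2 \<ge> 2\<close>; having two independent directions, one can write a generator as a commutator and
  so show that conjugating a generator divisible by a high power of \<open>s\<close> with a generator of
  denominator \<open>s\<close> gives a product of generators without denominators. The inverse of such a
  denominator is never formed: conjugation is expressed by an intertwining identity \<open>h' P = P h\<close>.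

  Hence, if \<open>\<theta>\<close> is locally a word in generators with denominator \<open>s\<close>, then
  \<open>\<theta>((a + s\<^sup>N T) X) = H(T) \<theta>(a X)\<close> up to \<open>s\<close>-torsion with \<open>H\<close> in the group over \<open>R[X, T]\<close>.
  Normalising \<open>H(0) = I\<close> makes the error divisible by \<open>T\<close>, so that it dies under \<open>T \<mapsto> s\<^sup>e T\<close>.
  The \<open>b\<close> in \<open>R\<close> for which \<open>\<theta>((a + b r) X)\<close> and \<open>\<theta>(a X)\<close> always differ by a group element
  form an ideal, which then lies in no maximal ideal; take \<open>b = r = 1\<close>, \<open>a = 0\<close>.
\<close>

section \<open>Invertibility of alternating matrices of Pfaffian one\<close>

text \<open>The constants come from one computation. With \<open>s\<close> inverted, the conjugate
  of I + y c by s I + d f is the transvection with column s y + (f y) d and row (s c - f) / s^2, a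
  generator of neither kind. Realising it costs \<open>s\<close> three more times: once in the
  commutator that uses a second direction, once to pass from a row along one basis vector to a
  general f, once to expand y in the basis. Together with s^2 this gives s^5. Both members of that
  commutator are available only with a factor k^2, which gives k^4. So crossing one letter takes
  level k^4 s^5 to level k, and \<open>deform_exp\<close> iterates this.

  Neither \<open>s\<close> nor 2 may be cancelled. Hence identities between matrices carry powers of
  \<open>s\<close>, orthogonality is required of a parameter before it is multiplied by the level,
  and zero diagonals are proved separately from skew-symmetry.\<close>

definition pf_perms :: "nat \<Rightarrow> (nat \<Rightarrow> nat) set" where
  "pf_perms k = {\<sigma>. \<sigma> permutes {..<2*k} \<and> (\<forall>i<k. \<sigma> (2*i) < \<sigma> (2*i+1))
                 \<and> (\<forall>i. i + 1 < k \<longrightarrow> \<sigma> (2*i) < \<sigma> (2*i+2))}"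

definition pf_term :: "nat \<Rightarrow> (nat \<Rightarrow> nat \<Rightarrow> 'a::comm_ring_1) \<Rightarrow> (nat \<Rightarrow> nat) \<Rightarrow> 'a" where
  "pf_term k A \<sigma> = of_int (sign \<sigma>) * (\<Prod>i<k. A (\<sigma> (2*i)) (\<sigma> (2*i+1)))"

definition pf :: "nat \<Rightarrow> (nat \<Rightarrow> nat \<Rightarrow> 'a::comm_ring_1) \<Rightarrow> 'a" where
  "pf k A = (\<Sum>\<sigma>\<in>pf_perms k. pf_term k A \<sigma>)"

text \<open>The diagonal is a separate condition: skew-symmetry gives only 2 A i i = 0, and 2 may be
  a zero divisor.\<close>

definition alternating_on :: "nat \<Rightarrow> (nat \<Rightarrow> nat \<Rightarrow> 'a::comm_ring_1) \<Rightarrow> bool" where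
  "alternating_on m A \<longleftrightarrow> (\<forall>i<m. A i i = 0) \<and> (\<forall>i<m. \<forall>j<m. A i j = - A j i)"

lemma alternating_on_diag: "alternating_on m A \<Longrightarrow> i < m \<Longrightarrow> A i i = 0"
  unfolding alternating_on_def by blast

lemma alternating_on_swap: "alternating_on m A \<Longrightarrow> i < m \<Longrightarrow> j < m \<Longrightarrow> A i j = - A j i"
  unfolding alternating_on_def by blast

text \<open>This forgets the order of the blocks and the order inside them. For alternating
  \<open>A\<close> the value of \<open>pf_term k A\<close> depends on this set alone, although the
  sign of the permutation does not.\<close>

definition matching :: "nat \<Rightarrow> (nat \<Rightarrow> nat) \<Rightarrow> nat set set" where
  "matching k \<sigma> = (\<lambda>i. {\<sigma> (2*i), \<sigma> (2*i+1)}) ` {..<k}"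

section \<open>Perfect matchings and their sorted permutations\<close>

lemma finite_pf_perms: "finite (pf_perms k)"
  unfolding pf_perms_def by (rule finite_subset[OF _ finite_permutations[of "{..<2*k}"]]) auto

lemma permutes_lessThan_permutation: "p permutes {..<m::nat} \<Longrightarrow> permutation p"
  unfolding permutation_permutes by blast

text \<open>The sign of the permutation and the factor of block \<open>i\<close> both change sign,
  so their product does not.\<close>

lemma pf_swap_pair:
  fixes \<sigma> :: "nat \<Rightarrow> nat"
  assumes \<sigma>: "\<sigma> permutes {..<2*k}" and i: "i < k"
  defines "\<sigma>' \<equiv> \<sigma> \<circ> transpose (2*i) (2*i+1)"
  shows "\<sigma>' permutes {..<2*k}" "matching k \<sigma>' = matching k \<sigma>"
    "alternating_on (2*k) A \<Longrightarrow> pf_term k A \<sigma>' = pf_term k A \<sigma>"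
proof -
  have T: "transpose (2*i) (2*i+1) permutes {..<2*k}" using i by (intro permutes_swap_id) auto
  show P: "\<sigma>' permutes {..<2*k}" unfolding \<sigma>'_def by (rule permutes_compose[OF T \<sigma>])
  have ev: "\<sigma>' (2*j) = (if j = i then \<sigma> (2*i+1) else \<sigma> (2*j))"
    and od: "\<sigma>' (2*j+1) = (if j = i then \<sigma> (2*i) else \<sigma> (2*j+1))" for j
    unfolding \<sigma>'_def by (auto simp: transpose_def; presburger)+
  show "matching k \<sigma>' = matching k \<sigma>"
    unfolding matching_def by (rule image_cong[OF refl]) (auto simp: ev od simp del: One_nat_def)
  assume A: "alternating_on (2*k) A"
  have "sign \<sigma>' = sign \<sigma> * sign (transpose (2*i) (2*i+1))"
    unfolding \<sigma>'_def using \<sigma> T by (intro sign_compose) (auto intro: permutes_lessThan_permutation)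
  then have s: "sign \<sigma>' = - sign \<sigma>" by (simp add: sign_swap_id)
  have "(\<Prod>j<k. A (\<sigma>' (2*j)) (\<sigma>' (2*j+1)))
     = A (\<sigma>' (2*i)) (\<sigma>' (2*i+1)) * (\<Prod>j\<in>{..<k}-{i}. A (\<sigma>' (2*j)) (\<sigma>' (2*j+1)))"
    using i by (intro prod.remove) auto
  also have "(\<Prod>j\<in>{..<k}-{i}. A (\<sigma>' (2*j)) (\<sigma>' (2*j+1))) = (\<Prod>j\<in>{..<k}-{i}. A (\<sigma> (2*j)) (\<sigma> (2*j+1)))"
    by (rule prod.cong) (auto simp: ev od simp del: One_nat_def)
  also have "A (\<sigma>' (2*i)) (\<sigma>' (2*i+1)) = - A (\<sigma> (2*i)) (\<sigma> (2*i+1))"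
  proof -
    have "\<sigma> (2*i) < 2*k" "\<sigma> (2*i+1) < 2*k" using i permutes_in_image[OF \<sigma>] by auto
    then have "A (\<sigma> (2*i+1)) (\<sigma> (2*i)) = - A (\<sigma> (2*i)) (\<sigma> (2*i+1))" by (intro alternating_on_swap[OF A])
    then show ?thesis unfolding ev od by simp
  qed
  also have "- A (\<sigma> (2*i)) (\<sigma> (2*i+1)) * (\<Prod>j\<in>{..<k}-{i}. A (\<sigma> (2*j)) (\<sigma> (2*j+1)))
     = - (\<Prod>j<k. A (\<sigma> (2*j)) (\<sigma> (2*j+1)))"
    using i by (subst (2) prod.remove[of _ i]) auto
  finally show "pf_term k A \<sigma>' = pf_term k A \<sigma>" unfolding pf_term_def s by simp
qed

text \<open>Exchanging two blocks takes two transpositions, an even permutation, and only reorders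
  the factors.\<close>

lemma pf_swap_adjacent:
  fixes \<sigma> :: "nat \<Rightarrow> nat"
  assumes \<sigma>: "\<sigma> permutes {..<2*k}" and i: "i + 1 < k"
  defines "\<sigma>' \<equiv> \<sigma> \<circ> (transpose (2*i) (2*i+2) \<circ> transpose (2*i+1) (2*i+3))"
  shows "\<sigma>' permutes {..<2*k}" "matching k \<sigma>' = matching k \<sigma>" "pf_term k A \<sigma>' = pf_term k A \<sigma>"
    "\<sigma>' (2*j) = \<sigma> (2 * transpose i (i+1) j)" "\<sigma>' (2*j+1) = \<sigma> (2 * transpose i (i+1) j + 1)"
proof -
  have T1: "transpose (2*i) (2*i+2) permutes {..<2*k}" using i by (intro permutes_swap_id) auto
  have T2: "transpose (2*i+1) (2*i+3) permutes {..<2*k}" using i by (intro permutes_swap_id) auto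
  have t: "transpose i (i+1) permutes {..<k}" using i by (intro permutes_swap_id) auto
  note T = permutes_compose[OF T2 T1]
  show P: "\<sigma>' permutes {..<2*k}" unfolding \<sigma>'_def by (rule permutes_compose[OF T \<sigma>])
  have "transpose (2*i) (2*i+2) (transpose (2*i+1) (2*i+3) (2*j)) = 2 * transpose i (i+1) j"
    "transpose (2*i) (2*i+2) (transpose (2*i+1) (2*i+3) (2*j+1)) = 2 * transpose i (i+1) j + 1" for j
    unfolding transpose_def by presburger+
  then show ev: "\<sigma>' (2*j) = \<sigma> (2 * transpose i (i+1) j)"
    and od: "\<sigma>' (2*j+1) = \<sigma> (2 * transpose i (i+1) j + 1)" for j
    unfolding \<sigma>'_def o_apply by simp_all
  have "matching k \<sigma>' = (\<lambda>j. {\<sigma> (2*j), \<sigma> (2*j+1)}) ` (transpose i (i+1) ` {..<k})"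
    unfolding matching_def image_image ev od ..
  then show "matching k \<sigma>' = matching k \<sigma>" using permutes_image[OF t] by (simp add: matching_def)
  have "sign \<sigma>' = sign \<sigma> * (sign (transpose (2*i) (2*i+2)) * sign (transpose (2*i+1) (2*i+3)))"
    unfolding \<sigma>'_def using \<sigma> T T1 T2
    by (subst sign_compose; (subst sign_compose)?) (auto intro: permutes_lessThan_permutation)
  then have s: "sign \<sigma>' = sign \<sigma>" by (simp add: sign_swap_id)
  have "(\<Prod>j<k. A (\<sigma>' (2*j)) (\<sigma>' (2*j+1))) = (\<Prod>j<k. A (\<sigma> (2*j)) (\<sigma> (2*j+1)))"
    unfolding ev od using prod.permute[OF t, of "\<lambda>j. A (\<sigma> (2*j)) (\<sigma> (2*j+1))"] by (simp add: o_def)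
  then show "pf_term k A \<sigma>' = pf_term k A \<sigma>" unfolding pf_term_def s by simp
qed

text \<open>Sorting a permutation into normal form increases this weight at every step.\<close>
definition pf_weight :: "nat \<Rightarrow> (nat \<Rightarrow> nat) \<Rightarrow> nat" where
  "pf_weight k \<sigma> = (\<Sum>i<k. i * \<sigma> (2*i) + k * \<sigma> (2*i+1))"

lemma pf_weight_bound: "\<sigma> permutes {..<2*k} \<Longrightarrow> pf_weight k \<sigma> \<le> k * (k * (2*k) + k * (2*k))"
proof -
  assume \<sigma>: "\<sigma> permutes {..<2*k}"
  have "\<sigma> (2*i) < 2*k" "\<sigma> (2*i+1) < 2*k" if "i < k" for i
    using that permutes_in_image[OF \<sigma>] by auto
  then have "pf_weight k \<sigma> \<le> (\<Sum>i<k. k * (2*k) + k * (2*k))"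
    unfolding pf_weight_def by (intro sum_mono add_mono mult_mono) (auto intro: less_imp_le)
  then show ?thesis by simp
qed

lemma rearrange_less:
  fixes i l x y :: nat
  assumes "i < l" "y < x" shows "i * x + l * y < i * y + l * x"
proof -
  obtain a b where "l = i + Suc a" "x = y + Suc b"
    using assms by (metis less_iff_Suc_add add_Suc_right)
  then show ?thesis by (simp add: algebra_simps)
qed

lemma pf_normal_form:
  assumes "alternating_on (2*k) A" "\<sigma> permutes {..<2*k}"
  shows "\<exists>\<nu>\<in>pf_perms k. matching k \<nu> = matching k \<sigma> \<and> pf_term k A \<nu> = pf_term k A \<sigma>"
  using assms(2)
proof (induction \<sigma> rule: measure_induct_rule[of "\<lambda>\<sigma>. k * (k * (2*k) + k * (2*k)) - pf_weight k \<sigma>"])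
  case (less \<sigma>)
  note \<sigma> = less.prems
  have step: ?case if "\<sigma>' permutes {..<2*k}" "matching k \<sigma>' = matching k \<sigma>" "pf_term k A \<sigma>' = pf_term k A \<sigma>"
    "pf_weight k \<sigma> < pf_weight k \<sigma>'" for \<sigma>'
  proof -
    have "k * (k * (2*k) + k * (2*k)) - pf_weight k \<sigma>' < k * (k * (2*k) + k * (2*k)) - pf_weight k \<sigma>"
      using that(4) pf_weight_bound[OF that(1)] by linarith
    from less.IH[OF this that(1)] show ?thesis using that by auto
  qed
  have inj: "\<sigma> x = \<sigma> y \<longleftrightarrow> x = y" for x y using permutes_inj[OF \<sigma>] by (auto dest: injD)
  consider "\<sigma> \<in> pf_perms k" | i where "i < k" "\<sigma> (2*i+1) < \<sigma> (2*i)" | i where "i + 1 < k" "\<sigma> (2*i+2) < \<sigma> (2*i)"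
  proof -
    have "\<sigma> (2*i+1) < \<sigma> (2*i)" if "\<not> \<sigma> (2*i) < \<sigma> (2*i+1)" for i
      using that inj[of "2*i" "2*i+1"] by linarith
    moreover have "\<sigma> (2*i+2) < \<sigma> (2*i)" if "\<not> \<sigma> (2*i) < \<sigma> (2*i+2)" for i
      using that inj[of "2*i" "2*i+2"] by linarith
    ultimately show ?thesis using that \<sigma> unfolding pf_perms_def by blast
  qed
  then show ?case
  proof cases
    case 1
    then show ?thesis by blast
  next
    case (2 i)
    let ?\<sigma> = "\<sigma> \<circ> transpose (2*i) (2*i+1)"
    have e: "?\<sigma> (2*j) = (if j = i then \<sigma> (2*i+1) else \<sigma> (2*j))"
      "?\<sigma> (2*j+1) = (if j = i then \<sigma> (2*i) else \<sigma> (2*j+1))" for j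
      by (auto simp: transpose_def; presburger)+
    have "(\<Sum>j\<in>{..<k}-{i}. j * ?\<sigma> (2*j) + k * ?\<sigma> (2*j+1)) = (\<Sum>j\<in>{..<k}-{i}. j * \<sigma> (2*j) + k * \<sigma> (2*j+1))"
      unfolding e by (rule sum.cong) auto
    \<comment> \<open>The larger entry moves to the second place of the block, whose weight
      \<open>k\<close> exceeds the weight \<open>i\<close> of the first place.\<close>
    moreover have "i * \<sigma> (2*i) + k * \<sigma> (2*i+1) < i * ?\<sigma> (2*i) + k * ?\<sigma> (2*i+1)"
      unfolding e using rearrange_less[OF 2] by simp
    ultimately have "pf_weight k \<sigma> < pf_weight k ?\<sigma>"
      unfolding pf_weight_def using 2(1) by (simp only: sum.remove[OF finite_lessThan, of i k] lessThan_iff)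
    then show ?thesis using step pf_swap_pair[OF \<sigma> 2(1)] assms(1) by blast
  next
    case (3 i)
    let ?\<sigma> = "\<sigma> \<circ> (transpose (2*i) (2*i+2) \<circ> transpose (2*i+1) (2*i+3))"
    note S = pf_swap_adjacent[OF \<sigma> 3(1)]
    let ?t = "transpose i (i+1)"
    have t: "?t permutes {..<k}" using 3 by (intro permutes_swap_id) auto
    have "pf_weight k ?\<sigma> = (\<Sum>j<k. ?t (?t j) * \<sigma> (2 * ?t j) + k * \<sigma> (2 * ?t j + 1))"
      unfolding pf_weight_def S(4,5) by simp
    also have "\<dots> = (\<Sum>j<k. ?t j * \<sigma> (2 * j) + k * \<sigma> (2 * j + 1))"
      using sum.permute[OF t, of "\<lambda>j. ?t j * \<sigma> (2 * j) + k * \<sigma> (2 * j + 1)"] by (simp add: o_def)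
    \<comment> \<open>All second places have the same weight \<open>k\<close>, so exchanging blocks
      affects only the sum over first places.\<close>
    finally have w': "pf_weight k ?\<sigma> = (\<Sum>j<k. ?t j * \<sigma> (2 * j)) + (\<Sum>j<k. k * \<sigma> (2 * j + 1))"
      by (simp add: sum.distrib)
    have w: "pf_weight k \<sigma> = (\<Sum>j<k. j * \<sigma> (2 * j)) + (\<Sum>j<k. k * \<sigma> (2 * j + 1))"
      by (simp add: pf_weight_def sum.distrib)
    have split: "(\<Sum>j<k. f j) = f i + (f (i+1) + (\<Sum>j\<in>{..<k}-{i}-{i+1}. f j))" for f :: "nat \<Rightarrow> nat"
      using 3(1) by (subst sum.remove[of _ i], simp, simp, subst sum.remove[of _ "i+1"]) auto
    have r: "(\<Sum>j\<in>{..<k}-{i}-{i+1}. ?t j * \<sigma> (2 * j)) = (\<Sum>j\<in>{..<k}-{i}-{i+1}. j * \<sigma> (2 * j))"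
      by (rule sum.cong) (auto simp: transpose_def)
    have "i * \<sigma> (2*i) + (i+1) * \<sigma> (2*i+2) < i * \<sigma> (2*i+2) + (i+1) * \<sigma> (2*i)"
      using 3(2) by (intro rearrange_less) auto
    then have "(\<Sum>j<k. j * \<sigma> (2 * j)) < (\<Sum>j<k. ?t j * \<sigma> (2 * j))"
      unfolding split r by simp
    then have "pf_weight k \<sigma> < pf_weight k ?\<sigma>" unfolding w w' by simp
    then show ?thesis using step S(1-3) by blast
  qed
qed

lemma matching_unique_partner:
  assumes \<sigma>: "\<sigma> permutes {..<2*k}" and "{x, y} \<in> matching k \<sigma>" "{x, z} \<in> matching k \<sigma>"
  shows "y = z"
proof -
  have inj: "\<sigma> x = \<sigma> y \<longleftrightarrow> x = y" for x y using permutes_inj[OF \<sigma>] by (auto dest: injD)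
  obtain i j where "{x, y} = {\<sigma> (2*i), \<sigma> (2*i+1)}" "{x, z} = {\<sigma> (2*j), \<sigma> (2*j+1)}"
    using assms(2,3) unfolding matching_def by blast
  then show ?thesis
    by (auto simp: doubleton_eq_iff inj; presburger)
qed

lemma matching_partner_exists:
  assumes \<sigma>: "\<sigma> permutes {..<2*k}" and x: "x < 2*k"
  shows "\<exists>y. {x, y} \<in> matching k \<sigma>"
proof -
  obtain p where p: "p < 2*k" "\<sigma> p = x"
    using permutes_image[OF \<sigma>] x by (metis imageE lessThan_iff)
  have "{\<sigma> (2*(p div 2)), \<sigma> (2*(p div 2)+1)} \<in> matching k \<sigma>"
    using p(1) unfolding matching_def by (intro imageI) auto
  moreover have "p = 2*(p div 2) \<or> p = 2*(p div 2)+1" by presburger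
  ultimately show ?thesis using p(2) by (metis insert_commute)
qed

text \<open>In normal form the first entries are the minima of the blocks in increasing order, so
  the matching determines them; the second entries are their partners.\<close>

lemma pf_perms_matching_inj:
  assumes \<mu>: "\<mu> \<in> pf_perms k" and \<nu>: "\<nu> \<in> pf_perms k" and eq: "matching k \<mu> = matching k \<nu>"
  shows "\<mu> = \<nu>"
proof -
  have sorted: "map (\<lambda>i. \<sigma> (2*i)) [0..<k] = sorted_list_of_set (Min ` matching k \<sigma>)" if "\<sigma> \<in> pf_perms k" for \<sigma>
  proof -
    have s: "\<sigma> (2*i) < \<sigma> (2*i+1)" if "i < k" for i using \<open>\<sigma> \<in> pf_perms k\<close> that unfolding pf_perms_def by blast
    have "Min ` matching k \<sigma> = (\<lambda>i. \<sigma> (2*i)) ` {..<k}"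
      unfolding matching_def image_image using s by (intro image_cong) (auto simp: min_def less_imp_le)
    also have "\<dots> = set (map (\<lambda>i. \<sigma> (2*i)) [0..<k])" by (auto simp: lessThan_atLeast0)
    finally have S: "Min ` matching k \<sigma> = set (map (\<lambda>i. \<sigma> (2*i)) [0..<k])" .
    have "sorted_wrt (<) (map (\<lambda>i. \<sigma> (2*i)) [0..<k])"
      unfolding sorted_wrt_iff_nth_Suc_transp[OF transp_on_less]
      using \<open>\<sigma> \<in> pf_perms k\<close> unfolding pf_perms_def by auto
    then show ?thesis unfolding S
      by (metis sorted_list_of_set.idem_if_sorted_distinct strict_sorted_iff)
  qed
  have "map (\<lambda>i. \<mu> (2*i)) [0..<k] = map (\<lambda>i. \<nu> (2*i)) [0..<k]"
    using sorted[OF \<mu>] sorted[OF \<nu>] eq by simp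
  then have ev: "\<mu> (2*i) = \<nu> (2*i)" if "i < k" for i using that by (auto simp: list_eq_iff_nth_eq)
  have pm: "\<mu> permutes {..<2*k}" and pn: "\<nu> permutes {..<2*k}" using \<mu> \<nu> unfolding pf_perms_def by auto
  have od: "\<mu> (2*i+1) = \<nu> (2*i+1)" if "i < k" for i
  proof -
    have "{\<nu> (2*i), \<mu> (2*i+1)} \<in> matching k \<nu>"
      using that unfolding eq[symmetric] ev[OF that, symmetric] by (auto simp: matching_def)
    moreover have "{\<nu> (2*i), \<nu> (2*i+1)} \<in> matching k \<nu>" using that by (auto simp: matching_def)
    ultimately show ?thesis by (rule matching_unique_partner[OF pn])
  qed
  show ?thesis
  proof
    fix p
    consider "\<not> p < 2*k" | i where "i < k" "p = 2*i" | i where "i < k" "p = 2*i+1"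
    proof -
      have "\<not> p < 2*k \<or> (\<exists>i<k. p = 2*i) \<or> (\<exists>i<k. p = 2*i+1)" by presburger
      then show ?thesis using that by blast
    qed
    then show "\<mu> p = \<nu> p"
    proof cases
      case 1
      then show ?thesis using permutes_not_in[OF pm] permutes_not_in[OF pn] by auto
    qed (use ev od in auto)
  qed
qed

text \<open>The two halves of the sum cancel; interchanging \<open>i\<close> and \<open>j\<close> alone would only give \<open>2 pf = 0\<close>.\<close>
lemma pf_equal_rows:
  fixes A :: "nat \<Rightarrow> nat \<Rightarrow> 'a::comm_ring_1"
  assumes alt: "alternating_on (2*k) A" and ij: "i < 2*k" "j < 2*k" "i \<noteq> j"
    and rows: "\<And>x. x < 2*k \<Longrightarrow> A i x = A j x"
  shows "pf k A = 0"
proof -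
  let ?\<tau> = "transpose i j"
  have \<tau>: "?\<tau> permutes {..<2*k}" using ij by (intro permutes_swap_id) auto
  have A0: "A x x = 0" "A x y = - A y x" if "x < 2*k" "y < 2*k" for x y
    using alt that unfolding alternating_on_def by blast+
  have cols: "A x i = A x j" if "x < 2*k" for x using rows[OF that] A0 that ij by metis
  have Aij: "A i j = 0" "A j i = 0"
    using rows[OF ij(2)] rows[OF ij(1)] A0(1)[OF ij(2) ij(2)] A0(1)[OF ij(1) ij(1)] by simp_all
  \<comment> \<open>Rows and columns \<open>i\<close> and \<open>j\<close> agree and the entries
    joining them vanish, so \<open>A\<close> is invariant under the transposition. Composing with it
    changes a term only through the sign.\<close>
  have inv: "A (?\<tau> x) (?\<tau> y) = A x y" if "x < 2*k" "y < 2*k" for x y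
    using that ij rows cols A0(1) Aij by (auto simp: transpose_def)
  have perm: "\<nu> permutes {..<2*k}" if "\<nu> \<in> pf_perms k" for \<nu> using that unfolding pf_perms_def by blast
  \<comment> \<open>The action of the transposition on matchings, carried back to normal forms; by
    \<open>pf_perms_matching_inj\<close> the choice is unique.\<close>
  define g where "g \<nu> = (SOME \<mu>. \<mu> \<in> pf_perms k \<and> matching k \<mu> = (`) ?\<tau> ` matching k \<nu> \<and> pf_term k A \<mu> = - pf_term k A \<nu>)" for \<nu>
  have g: "g \<nu> \<in> pf_perms k" "matching k (g \<nu>) = (`) ?\<tau> ` matching k \<nu>" "pf_term k A (g \<nu>) = - pf_term k A \<nu>"
    if \<nu>: "\<nu> \<in> pf_perms k" for \<nu>
  proof -
    have p: "?\<tau> \<circ> \<nu> permutes {..<2*k}" by (rule permutes_compose[OF perm[OF \<nu>] \<tau>])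
    have "sign (?\<tau> \<circ> \<nu>) = sign ?\<tau> * sign \<nu>"
      using \<tau> perm[OF \<nu>] by (intro sign_compose) (auto intro: permutes_lessThan_permutation)
    then have "sign (?\<tau> \<circ> \<nu>) = - sign \<nu>" using ij by (simp add: sign_swap_id)
    moreover have "(\<Prod>x<k. A ((?\<tau> \<circ> \<nu>) (2*x)) ((?\<tau> \<circ> \<nu>) (2*x+1))) = (\<Prod>x<k. A (\<nu> (2*x)) (\<nu> (2*x+1)))"
      using permutes_in_image[OF perm[OF \<nu>]] by (intro prod.cong) (auto simp: inv)
    ultimately have "pf_term k A (?\<tau> \<circ> \<nu>) = - pf_term k A \<nu>" by (simp add: pf_term_def)
    moreover have "matching k (?\<tau> \<circ> \<nu>) = (`) ?\<tau> ` matching k \<nu>"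
      by (simp add: matching_def image_image)
    ultimately have "\<exists>\<mu>. \<mu> \<in> pf_perms k \<and> matching k \<mu> = (`) ?\<tau> ` matching k \<nu> \<and> pf_term k A \<mu> = - pf_term k A \<nu>"
      using pf_normal_form[OF alt p] by metis
    from someI_ex[OF this, folded g_def]
    show "g \<nu> \<in> pf_perms k" "matching k (g \<nu>) = (`) ?\<tau> ` matching k \<nu>" "pf_term k A (g \<nu>) = - pf_term k A \<nu>" by blast+
  qed
  have gg: "g (g \<nu>) = \<nu>" if "\<nu> \<in> pf_perms k" for \<nu>
  proof (rule pf_perms_matching_inj)
    show "matching k (g (g \<nu>)) = matching k \<nu>"
      using g[OF that] g(2)[of "g \<nu>"] by (simp add: image_image)
  qed (use g that in auto)
  \<comment> \<open>\<open>x\<close> and \<open>y\<close> are the partners of \<open>i\<close> and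
    \<open>j\<close>. The transposition exchanges them, hence maps the matchings with x < y onto
    those with y < x. Matchings that join \<open>i\<close> to \<open>j\<close> contribute 0.\<close>
  define P where "P \<nu> x y \<longleftrightarrow> {i, x} \<in> matching k \<nu> \<and> {j, y} \<in> matching k \<nu>" for \<nu> x y
  define N1 where "N1 = {\<nu> \<in> pf_perms k. {i, j} \<notin> matching k \<nu> \<and> (\<exists>x y. P \<nu> x y \<and> x < y)}"
  define N2 where "N2 = {\<nu> \<in> pf_perms k. {i, j} \<notin> matching k \<nu> \<and> (\<exists>x y. P \<nu> x y \<and> y < x)}"
  have gP: "{i, j} \<notin> matching k (g \<nu>) \<and> P (g \<nu>) y x"
    if \<nu>: "\<nu> \<in> pf_perms k" "{i, j} \<notin> matching k \<nu>" "P \<nu> x y" for \<nu> x y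
  proof
    show "{i, j} \<notin> matching k (g \<nu>)"
    proof
      assume "{i, j} \<in> matching k (g \<nu>)"
      then have "?\<tau> ` {i, j} \<in> matching k (g (g \<nu>))" using g(2)[OF g(1)[OF \<nu>(1)]] by blast
      then show False using \<nu>(2) gg[OF \<nu>(1)] by (simp add: insert_commute)
    qed
    have ne: "x \<noteq> j" "y \<noteq> i" using \<nu>(2,3) unfolding P_def by (auto simp: insert_commute)
    have ne': "x \<noteq> i" "y \<noteq> j"
    proof -
      have "{z} \<notin> matching k \<nu>" for z
        using permutes_inj[OF perm[OF \<nu>(1)]] by (auto simp: matching_def dest: injD)
      then show "x \<noteq> i" "y \<noteq> j" using \<nu>(3) unfolding P_def by auto
    qed
    have "?\<tau> ` {i, x} = {j, x}" "?\<tau> ` {j, y} = {i, y}" using ne ne' by (auto simp: transpose_def)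
    then show "P (g \<nu>) y x" using \<nu>(3) g(2)[OF \<nu>(1)] unfolding P_def by (metis imageI)
  qed
  have split: "pf k A = (\<Sum>\<nu>\<in>N1. pf_term k A \<nu>) + (\<Sum>\<nu>\<in>N2. pf_term k A \<nu>)"
  proof -
    have fin: "finite N1" "finite N2" using finite_pf_perms unfolding N1_def N2_def by auto
    have uniq: "x = x' \<and> y = y'" if "\<nu> \<in> pf_perms k" "P \<nu> x y" "P \<nu> x' y'" for \<nu> x y x' y'
      using that matching_unique_partner[OF perm[OF that(1)]] unfolding P_def by blast
    have dis: "N1 \<inter> N2 = {}"
      unfolding N1_def N2_def using uniq by (fastforce dest: order.asym)
    have "pf_term k A \<nu> = 0" if "\<nu> \<in> pf_perms k - (N1 \<union> N2)" for \<nu>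
    proof -
      have \<nu>: "\<nu> \<in> pf_perms k" using that by blast
      have "{i, j} \<in> matching k \<nu>"
      proof (rule ccontr)
        assume n: "{i, j} \<notin> matching k \<nu>"
        obtain x y where xy: "P \<nu> x y"
          unfolding P_def using matching_partner_exists[OF perm[OF \<nu>]] ij by blast
        have "x \<noteq> y" using xy matching_unique_partner[OF perm[OF \<nu>], of x i j] ij
          unfolding P_def by (auto simp: insert_commute)
        then have "x < y \<or> y < x" by auto
        then show False using that n xy \<nu> unfolding N1_def N2_def by blast
      qed
      then obtain l where l: "l < k" "{i, j} = {\<nu> (2*l), \<nu> (2*l+1)}" unfolding matching_def by blast
      have "A (\<nu> (2*l)) (\<nu> (2*l+1)) = 0"
        using l(2) Aij by (auto simp: doubleton_eq_iff)
      then have "(\<Prod>x<k. A (\<nu> (2*x)) (\<nu> (2*x+1))) = 0" using l(1) by (intro prod_zero) auto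
      then show ?thesis by (simp add: pf_term_def)
    qed
    then have "pf k A = (\<Sum>\<nu>\<in>N1 \<union> N2. pf_term k A \<nu>)"
      unfolding pf_def by (intro sum.mono_neutral_right finite_pf_perms) (auto simp: N1_def N2_def)
    then show ?thesis using sum.union_disjoint[OF fin dis] by simp
  qed
  have N: "N1 \<subseteq> pf_perms k" "N2 \<subseteq> pf_perms k" by (auto simp: N1_def N2_def)
  have g12: "g \<nu> \<in> N2" if \<nu>: "\<nu> \<in> N1" for \<nu>
  proof -
    obtain x y where xy: "P \<nu> x y" "x < y" "\<nu> \<in> pf_perms k" "{i, j} \<notin> matching k \<nu>" using \<nu> unfolding N1_def by blast
    then show ?thesis using gP[OF xy(3,4,1)] g(1)[OF xy(3)] unfolding N2_def by blast
  qed
  have g21: "g \<nu> \<in> N1" if \<nu>: "\<nu> \<in> N2" for \<nu>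
  proof -
    obtain x y where xy: "P \<nu> x y" "y < x" "\<nu> \<in> pf_perms k" "{i, j} \<notin> matching k \<nu>" using \<nu> unfolding N2_def by blast
    then show ?thesis using gP[OF xy(3,4,1)] g(1)[OF xy(3)] unfolding N1_def by blast
  qed
  have "(\<Sum>\<nu>\<in>N2. pf_term k A \<nu>) = (\<Sum>\<nu>\<in>N1. - pf_term k A \<nu>)"
  proof (rule sum.reindex_bij_witness[of _ g g])
    show "g (g \<nu>) = \<nu>" "g \<nu> \<in> N2" if "\<nu> \<in> N1" for \<nu> using that gg[of \<nu>] g12 N(1) by auto
    show "g (g \<nu>) = \<nu>" "g \<nu> \<in> N1" "- pf_term k A (g \<nu>) = pf_term k A \<nu>" if "\<nu> \<in> N2" for \<nu>
      using that gg[of \<nu>] g21 N(2) g(3)[of \<nu>] by auto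
  qed
  then show ?thesis using split by (simp add: sum_negf)
qed

text \<open>Column \<open>i\<close> changes along with row \<open>i\<close>, and their common entry
  is 0, so that the result is alternating again. The Pfaffians of these matrices take the place of
  cofactors.\<close>

definition replace_row :: "(nat \<Rightarrow> nat \<Rightarrow> 'a::comm_ring_1) \<Rightarrow> nat \<Rightarrow> (nat \<Rightarrow> 'a) \<Rightarrow> nat \<Rightarrow> nat \<Rightarrow> 'a" where
  "replace_row A i y = (\<lambda>a b. if a = i then (if b = i then 0 else y b) else if b = i then - y a else A a b)"

lemma replace_row_alternating: "alternating_on m A \<Longrightarrow> alternating_on m (replace_row A i y)"
  unfolding alternating_on_def[of m "replace_row A i y"]
  by (simp add: replace_row_def alternating_on_diag) (blast intro: alternating_on_swap)

text \<open>The index \<open>i\<close> lies in exactly one block of each matching, so each term has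
  a single factor involving \<open>y\<close>, and this factor is linear in \<open>y\<close>.\<close>

lemma pf_replace_row_linear:
  fixes A :: "nat \<Rightarrow> nat \<Rightarrow> 'a::comm_ring_1"
  assumes i: "i < 2*k"
  shows "pf k (replace_row A i y) = (\<Sum>x<2*k. y x * pf k (replace_row A i (\<lambda>z. if z = x then 1 else 0)))"
proof -
  have "pf_term k (replace_row A i y) \<nu> = (\<Sum>x<2*k. y x * pf_term k (replace_row A i (\<lambda>z. if z = x then 1 else 0)) \<nu>)"
    if "\<nu> \<in> pf_perms k" for \<nu>
  proof -
    have \<nu>: "\<nu> permutes {..<2*k}" using that unfolding pf_perms_def by blast
    have inj: "\<nu> x = \<nu> y \<longleftrightarrow> x = y" for x y using permutes_inj[OF \<nu>] by (auto dest: injD)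
    obtain p where p: "p < 2*k" "\<nu> p = i" using permutes_image[OF \<nu>] i by (metis imageE lessThan_iff)
    define l where "l = p div 2"
    have l: "l < k" "p = 2*l \<or> p = 2*l+1" using p(1) unfolding l_def by presburger+
    define R where "R = (\<Prod>x\<in>{..<k}-{l}. A (\<nu> (2*x)) (\<nu> (2*x+1)))"
    have other: "\<nu> (2*x) \<noteq> i" "\<nu> (2*x+1) \<noteq> i" if "x \<noteq> l" for x
      using that l(2) unfolding p(2)[symmetric] inj by presburger+
    have t: "pf_term k (replace_row A i z) \<nu> = of_int (sign \<nu>) * (replace_row A i z (\<nu> (2*l)) (\<nu> (2*l+1)) * R)" for z
    proof -
      have "(\<Prod>x\<in>{..<k}-{l}. replace_row A i z (\<nu> (2*x)) (\<nu> (2*x+1))) = R"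
        unfolding R_def by (rule prod.cong) (use other in \<open>auto simp: replace_row_def\<close>)
      then show ?thesis unfolding pf_term_def using l(1) by (subst prod.remove[of _ l]) auto
    qed
    have lt: "\<nu> (2*l) < 2*k" "\<nu> (2*l+1) < 2*k" using l(1) permutes_in_image[OF \<nu>] by auto
    have delta: "(\<Sum>x<2*k. y x * (if b = x then 1 else 0)) = y b" if "b < 2*k" for b
    proof -
      have "(\<Sum>x<2*k. y x * (if b = x then 1 else 0)) = (\<Sum>x<2*k. if b = x then y x else 0)"
        by (rule sum.cong) auto
      then show ?thesis using that by (simp add: sum.delta')
    qed
    have "replace_row A i y (\<nu> (2*l)) (\<nu> (2*l+1))
       = (\<Sum>x<2*k. y x * replace_row A i (\<lambda>z. if z = x then 1 else 0) (\<nu> (2*l)) (\<nu> (2*l+1)))"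
      using l(2)
    proof
      assume e: "p = 2*l"
      then have "\<nu> (2*l) = i" "\<nu> (2*l+1) \<noteq> i" using p(2) inj[of "2*l+1" p] by auto
      then show ?thesis using delta[OF lt(2)] by (simp add: replace_row_def)
    next
      assume e: "p = 2*l+1"
      then have "\<nu> (2*l+1) = i" "\<nu> (2*l) \<noteq> i" using p(2) inj[of "2*l" p] by auto
      then show ?thesis using delta[OF lt(1)] by (simp add: replace_row_def sum_negf)
    qed
    then show ?thesis unfolding t by (simp add: sum_distrib_left sum_distrib_right mult_ac)
  qed
  then show ?thesis unfolding pf_def sum_distrib_left by (subst sum.swap) (rule sum.cong, auto)
qed

lemma pf_cong: "(\<And>i j. i < 2*k \<Longrightarrow> j < 2*k \<Longrightarrow> A i j = B i j) \<Longrightarrow> pf k A = pf k B"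
  unfolding pf_def pf_term_def
proof (intro sum.cong refl arg_cong2[of _ _ _ _ "(*)"] prod.cong)
  fix \<sigma> x assume AB: "\<And>i j. i < 2*k \<Longrightarrow> j < 2*k \<Longrightarrow> A i j = B i j" and "\<sigma> \<in> pf_perms k" "x \<in> {..<k}"
  then have "\<sigma> (2*x) < 2*k" "\<sigma> (2*x+1) < 2*k"
    using permutes_in_image[of \<sigma> "{..<2*k}"] unfolding pf_perms_def by auto
  then show "A (\<sigma> (2*x)) (\<sigma> (2*x+1)) = B (\<sigma> (2*x)) (\<sigma> (2*x+1))" by (rule AB)
qed

section \<open>Cramer's rule with Pfaffians\<close>

lemma alternating_mat_on:
  assumes "\<phi> \<in> carrier_mat m m" "alternating_mat \<phi>"
  shows "alternating_on m (\<lambda>i j. \<phi> $$ (i,j))"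
proof -
  obtain \<nu> where "\<nu> \<in> carrier_mat m m" "\<phi> = \<nu> - transpose_mat \<nu>"
    using assms unfolding alternating_mat_def by auto
  then show ?thesis unfolding alternating_on_def by auto
qed

lemma alternating_skew:
  assumes "\<phi> \<in> carrier_mat m m" "alternating_mat \<phi>"
  shows "transpose_mat \<phi> = - \<phi>"
proof (rule eq_matI, goal_cases)
  case (1 i j)
  then show ?case using assms(1) alternating_on_swap[OF alternating_mat_on[OF assms], of j i] by simp
qed (use assms in auto)

text \<open>Row \<open>j\<close> of \<open>\<phi>\<close> times column \<open>i\<close> of
  \<open>B\<close> is the Pfaffian of \<open>\<phi>\<close> with row \<open>i\<close> replaced by
  row \<open>j\<close>. For j = i this is the Pfaffian of \<open>\<phi>\<close>; otherwise two rows
  are equal.\<close>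

lemma pfaffian_one_invertible:
  fixes \<phi> :: "'a::comm_ring_1 mat"
  assumes \<phi>: "\<phi> \<in> carrier_mat (2*n) (2*n)" and alt: "alternating_mat \<phi>" and pf1: "pfaffian \<phi> = 1"
  shows "\<exists>B \<in> carrier_mat (2*n) (2*n). \<phi> * B = 1\<^sub>m (2*n) \<and> B * \<phi> = 1\<^sub>m (2*n)"
proof -
  let ?A = "\<lambda>i j. \<phi> $$ (i,j)"
  have A: "alternating_on (2*n) ?A" by (rule alternating_mat_on[OF \<phi> alt])
  have pf: "pf n ?A = 1"
    using pf1 \<phi> unfolding pfaffian_def pf_def pf_term_def pf_perms_def by simp
  define b where "b i x = pf n (replace_row ?A i (\<lambda>z. if z = x then 1 else 0))" for i x
  define B where "B = mat (2*n) (2*n) (\<lambda>(x,i). b i x)"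
  have B: "B \<in> carrier_mat (2*n) (2*n)" by (simp add: B_def)
  have row: "(\<Sum>x<2*n. ?A j x * b i x) = (if j = i then 1 else 0)" if ij: "i < 2*n" "j < 2*n" for i j
  proof -
    have "(\<Sum>x<2*n. ?A j x * b i x) = pf n (replace_row ?A i (?A j))"
      unfolding b_def by (rule pf_replace_row_linear[symmetric, OF ij(1)])
    also have "\<dots> = (if j = i then 1 else 0)"
    proof (cases "j = i")
      case True
      have "pf n (replace_row ?A i (?A j)) = pf n ?A"
      proof (rule pf_cong)
        fix a b assume ab: "a < 2*n" "b < 2*n"
        show "replace_row ?A i (?A j) a b = ?A a b"
          using alternating_on_diag[OF A ij(1)] alternating_on_swap[OF A ab(1) ij(1)] True
          by (auto simp: replace_row_def)
      qed
      then show ?thesis using True pf by simp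
    next
      case False
      have "pf n (replace_row ?A i (?A j)) = 0"
      proof (rule pf_equal_rows[OF replace_row_alternating[OF A] ij])
        show "i \<noteq> j" using False by simp
        fix x assume "x < 2*n"
        then show "replace_row ?A i (?A j) i x = replace_row ?A i (?A j) j x"
          using alternating_on_diag[OF A ij(2)] False by (auto simp: replace_row_def)
      qed
      then show ?thesis using False by simp
    qed
    finally show ?thesis .
  qed
  have 1: "\<phi> * B = 1\<^sub>m (2*n)"
  proof (rule eq_matI, goal_cases)
    case (1 j i)
    then have "(\<phi> * B) $$ (j,i) = (\<Sum>x<2*n. ?A j x * b i x)"
      using \<phi> by (simp add: scalar_prod_def B_def lessThan_atLeast0)
    then show ?case using row[of i j] 1 by simp
  qed (use \<phi> B in auto)
  \<comment> \<open>Transposing \<phi> B = I and using skew-symmetry turns the right inverse into a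
    left inverse; the two then coincide.\<close>
  let ?C = "- transpose_mat B"
  have C: "?C \<in> carrier_mat (2*n) (2*n)" using B by simp
  have "?C * \<phi> = transpose_mat B * (- \<phi>)" using B \<phi> by simp
  also have "\<dots> = transpose_mat (\<phi> * B)"
    by (simp add: transpose_mult[OF \<phi> B] alternating_skew[OF \<phi> alt])
  finally have 2: "?C * \<phi> = 1\<^sub>m (2*n)" unfolding 1 by simp
  have "?C = ?C * (\<phi> * B)" unfolding 1 using C by simp
  also have "\<dots> = (?C * \<phi>) * B" using C \<phi> B by (simp add: assoc_mult_mat[of _ "2*n" "2*n" _ "2*n" _ "2*n"])
  also have "\<dots> = B" unfolding 2 using B by simp
  finally show ?thesis using 1 2 B by metis
qed

section \<open>Transvections\<close>

definition dot :: "nat \<Rightarrow> (nat \<Rightarrow> 'a::comm_ring_1) \<Rightarrow> (nat \<Rightarrow> 'a) \<Rightarrow> 'a" where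
  "dot n u v = (\<Sum>i<n. u i * v i)"

lemma dot_commute: "dot n u v = dot n v u"
  by (simp add: dot_def mult.commute)

lemma dot_add_left [simp]: "dot n (\<lambda>i. a i + b i) v = dot n a v + dot n b v"
  by (simp add: dot_def distrib_right sum.distrib)

lemma dot_diff_left [simp]: "dot n (\<lambda>i. a i - b i) v = dot n a v - dot n b v"
  by (simp add: dot_def left_diff_distrib sum_subtractf)

lemma dot_uminus_left [simp]: "dot n (\<lambda>i. - a i) v = - dot n a v"
  by (simp add: dot_def sum_negf)

lemma dot_scale_left [simp]: "dot n (\<lambda>i. k * a i) v = k * dot n a v"
  by (simp add: dot_def sum_distrib_left mult.assoc)

lemma dot_scale_left' [simp]: "dot n (\<lambda>i. a i * k) v = dot n a v * k"
  by (simp add: dot_def sum_distrib_right mult_ac)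

lemma dot_zero_left [simp]: "dot n (\<lambda>i. 0) v = 0"
  by (simp add: dot_def)

lemma dot_add_right [simp]: "dot n v (\<lambda>i. a i + b i) = dot n v a + dot n v b"
  by (simp add: dot_commute[of n v])

lemma dot_diff_right [simp]: "dot n v (\<lambda>i. a i - b i) = dot n v a - dot n v b"
  by (simp add: dot_commute[of n v])

lemma dot_uminus_right [simp]: "dot n v (\<lambda>i. - a i) = - dot n v a"
  by (simp add: dot_commute[of n v])

lemma dot_scale_right [simp]: "dot n v (\<lambda>i. k * a i) = k * dot n v a"
  by (simp add: dot_commute[of n v])

lemma dot_scale_right' [simp]: "dot n v (\<lambda>i. a i * k) = dot n v a * k"
  by (simp add: dot_commute[of n v])

lemma dot_zero_right [simp]: "dot n v (\<lambda>i. 0) = 0"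
  by (simp add: dot_def)

lemma dot_sum_right: "dot n v (\<lambda>k. \<Sum>i\<in>I. a i k) = (\<Sum>i\<in>I. dot n v (a i))"
  by (simp add: dot_def sum_distrib_left sum.swap[of _ I])

lemma dot_cong: "(\<And>i. i < n \<Longrightarrow> u i = u' i) \<Longrightarrow> (\<And>i. i < n \<Longrightarrow> v i = v' i) \<Longrightarrow> dot n u v = dot n u' v'"
  by (simp add: dot_def)

text \<open>For s = 1 and v u = 0 this is a transvection. A general \<open>s\<close> gives
  \<open>s\<close> times the transvection with parameter divided by \<open>s\<close>, so that no
  fractions have to be formed.\<close>

definition emat :: "nat \<Rightarrow> 'a::comm_ring_1 \<Rightarrow> (nat \<Rightarrow> 'a) \<Rightarrow> (nat \<Rightarrow> 'a) \<Rightarrow> 'a mat" where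
  "emat n s u v = mat n n (\<lambda>(i,j). (if i = j then s else 0) + u i * v j)"

lemma emat_carrier [simp]: "emat n s u v \<in> carrier_mat n n"
  by (simp add: emat_def)

lemma emat_dim [simp]: "dim_row (emat n s u v) = n" "dim_col (emat n s u v) = n"
  by (simp_all add: emat_def)

lemma emat_index [simp]:
  "i < n \<Longrightarrow> j < n \<Longrightarrow> emat n s u v $$ (i,j) = (if i = j then s else 0) + u i * v j"
  by (simp add: emat_def)

lemma emat_cong:
  "(\<And>i j. i < n \<Longrightarrow> j < n \<Longrightarrow> u i * v j = u' i * v' j) \<Longrightarrow> emat n s u v = emat n s u' v'"
  by (rule eq_matI) auto

lemma emat_in_cong:
  "emat n s u v \<in> S \<Longrightarrow> (\<And>i j. i < n \<Longrightarrow> j < n \<Longrightarrow> u' i * v' j = u i * v j) \<Longrightarrow> emat n s u' v' \<in> S"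
  using emat_cong[of n u' v' u v s] by simp

lemma emat_mult:
  "emat n s u v * emat n s' u' v' = mat n n (\<lambda>(i,j). (if i = j then s * s' else 0)
     + s * (u' i * v' j) + s' * (u i * v j) + dot n v u' * (u i * v' j))"
proof (rule eq_matI, goal_cases)
  case (1 i j)
  then have ij: "i < n" "j < n" by auto
  have "(emat n s u v * emat n s' u' v') $$ (i,j)
     = (\<Sum>k<n. emat n s u v $$ (i,k) * emat n s' u' v' $$ (k,j))"
    using ij by (simp add: scalar_prod_def lessThan_atLeast0 del: emat_index)
  also have "\<dots> = (\<Sum>k<n. ((if i = k then s * ((if k = j then s' else 0) + u' k * v' j) else 0)
      + (if k = j then u i * v k * s' else 0)) + v k * u' k * (u i * v' j))"
    using ij by (intro sum.cong refl) (auto simp: algebra_simps)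
  also have "\<dots> = (s * ((if i = j then s' else 0) + u' i * v' j) + u i * v j * s') + dot n v u' * (u i * v' j)"
    using ij by (simp add: sum.distrib sum.delta' sum.delta dot_def sum_distrib_right)
  finally show ?case using ij by (simp add: algebra_simps)
qed auto

lemma transpose_emat: "transpose_mat (emat n s u v) = emat n s v u"
  by (rule eq_matI) auto

lemma emat_one_zero: "emat n 1 (\<lambda>i. 0) v = 1\<^sub>m n" "emat n 1 v (\<lambda>i. 0) = 1\<^sub>m n"
  by (auto intro!: eq_matI)

lemma emat_add_left:
  "dot n v u' = 0 \<Longrightarrow> emat n 1 u v * emat n 1 u' v = emat n 1 (\<lambda>i. u i + u' i) v"
  unfolding emat_mult by (rule eq_matI) (auto simp: algebra_simps)

lemma emat_add_right:
  "dot n v u = 0 \<Longrightarrow> emat n 1 u v * emat n 1 u v' = emat n 1 u (\<lambda>i. v i + v' i)"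
  unfolding emat_mult by (rule eq_matI) (auto simp: algebra_simps)

lemma emat_inverse: "dot n v u = 0 \<Longrightarrow> emat n 1 u v * emat n 1 (\<lambda>i. - u i) v = 1\<^sub>m n"
  by (subst emat_add_left) (auto simp: emat_one_zero)

text \<open>The column of one factor is joined to the row of the other. This is how transvections
  whose row is not \<open>c\<close> and whose column is not \<open>d\<close> enter the
  group.\<close>

lemma emat_commutator:
  assumes "dot n v' u = 0" "dot n v u = 0" "dot n v' u' = 0"
  shows "emat n 1 u v * emat n 1 u' v' * (emat n 1 (\<lambda>i. - u i) v * emat n 1 (\<lambda>i. - u' i) v')
    = emat n 1 (\<lambda>i. dot n v u' * u i) v'"
proof -
  let ?T = "emat n 1 u v" let ?T' = "emat n 1 u' v'" let ?C = "emat n 1 (\<lambda>i. dot n v u' * u i) v'"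
  let ?S = "emat n 1 (\<lambda>i. - u i) v" let ?S' = "emat n 1 (\<lambda>i. - u' i) v'"
  \<comment> \<open>The two orders of multiplication are compared first, without inverses; the
    inverses are cancelled afterwards.\<close>
  have "?C * ?T' * ?T = emat n 1 (\<lambda>i. dot n v u' * u i + u' i) v' * ?T"
    by (subst emat_add_left) (simp_all add: assms)
  also have "\<dots> = ?T * ?T'"
    unfolding emat_mult using assms by (auto intro!: eq_matI simp: algebra_simps)
  finally have "?T * ?T' * (?S * ?S') = ?C * ?T' * ?T * (?S * ?S')" by simp
  also have "\<dots> = ?C * (?T' * ((?T * ?S) * ?S'))"
    by (simp add: assoc_mult_mat[where ?n\<^sub>1.0=n and ?n\<^sub>2.0=n and ?n\<^sub>3.0=n and ?n\<^sub>4.0=n] mult_carrier_mat[where nr=n and n=n and nc=n])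
  also have "\<dots> = ?C"
    using assms by (simp add: emat_inverse left_mult_one_mat[where nr=n and nc=n] right_mult_one_mat[where nr=n and nc=n])
  finally show ?thesis .
qed

text \<open>The group at level \<open>k\<close>. The equations on \<open>y\<close> and
  \<open>f\<close> survive ring homomorphisms and are exchanged by transposition. They are imposed
  on \<open>y\<close> and \<open>f\<close> rather than on their multiples by \<open>k\<close>,
  because \<open>k\<close> may be a zero divisor. Closure under inverses is proved in
  \<open>trvs_inverse\<close>: a generator is inverted by negating its parameter.\<close>

inductive_set trvs :: "nat \<Rightarrow> (nat \<Rightarrow> 'a::comm_ring_1) \<Rightarrow> (nat \<Rightarrow> 'a) \<Rightarrow> 'a \<Rightarrow> 'a mat set"
  for n c d k where
  one: "1\<^sub>m n \<in> trvs n c d k"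
| mult: "g \<in> trvs n c d k \<Longrightarrow> h \<in> trvs n c d k \<Longrightarrow> g * h \<in> trvs n c d k"
| beta: "dot n c y = 0 \<Longrightarrow> emat n 1 (\<lambda>i. k * y i) c \<in> trvs n c d k"
| alpha: "dot n f d = 0 \<Longrightarrow> emat n 1 d (\<lambda>i. k * f i) \<in> trvs n c d k"

lemma trvs_carrier: "g \<in> trvs n c d k \<Longrightarrow> g \<in> carrier_mat n n"
  by (induction rule: trvs.induct) auto

lemma trvs_dvd_mono:
  assumes "k dvd k'" "g \<in> trvs n c d k'" shows "g \<in> trvs n c d k"
  using assms(2)
proof (induction rule: trvs.induct)
  case (beta y)
  obtain l where "k' = k * l" using assms(1) by auto
  then show ?case using trvs.beta[of n c "\<lambda>i. l * y i" k d] beta by (simp add: mult.assoc)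
next
  case (alpha f)
  obtain l where "k' = k * l" using assms(1) by auto
  then show ?case using trvs.alpha[of n "\<lambda>i. l * f i" d k c] alpha by (simp add: mult.assoc)
qed (auto intro: trvs.intros)

text \<open>Columns become rows, so \<beta> and \<alpha> trade places. Together with the dual frame
  this lets one conjugation computation serve both kinds.\<close>

lemma trvs_transpose: "g \<in> trvs n c d k \<Longrightarrow> transpose_mat g \<in> trvs n d c k"
proof (induction rule: trvs.induct)
  case (mult g h)
  then show ?case
    by (simp add: transpose_mult[OF trvs_carrier[OF mult(1)] trvs_carrier[OF mult(2)]] trvs.mult)
qed (auto simp: transpose_emat intro: trvs.intros simp: dot_commute)

lemma trvs_inverse:
  "g \<in> trvs n c d k \<Longrightarrow> \<exists>h \<in> trvs n c d k. g * h = 1\<^sub>m n \<and> h * g = 1\<^sub>m n"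
proof (induction rule: trvs.induct)
  case one
  then show ?case by (auto intro!: bexI[of _ "1\<^sub>m n"] trvs.one)
next
  case (mult g h)
  then obtain g' h' where gh: "g' \<in> trvs n c d k" "g * g' = 1\<^sub>m n" "g' * g = 1\<^sub>m n"
    "h' \<in> trvs n c d k" "h * h' = 1\<^sub>m n" "h' * h = 1\<^sub>m n" by blast
  note C = trvs_carrier[OF mult(1)] trvs_carrier[OF mult(2)] trvs_carrier[OF gh(1)] trvs_carrier[OF gh(4)]
  have "g * h * (h' * g') = g * ((h * h') * g')"
    using C by (simp add: assoc_mult_mat[where ?n\<^sub>1.0=n and ?n\<^sub>2.0=n and ?n\<^sub>3.0=n and ?n\<^sub>4.0=n])
  also have "\<dots> = 1\<^sub>m n" using gh C by simp
  finally have 1: "g * h * (h' * g') = 1\<^sub>m n" .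
  have "h' * g' * (g * h) = h' * ((g' * g) * h)"
    using C by (simp add: assoc_mult_mat[where ?n\<^sub>1.0=n and ?n\<^sub>2.0=n and ?n\<^sub>3.0=n and ?n\<^sub>4.0=n])
  also have "\<dots> = 1\<^sub>m n" using gh C by simp
  finally show ?case using 1 gh by (meson trvs.mult)
next
  case (beta y)
  have "emat n 1 (\<lambda>i. k * y i) c * emat n 1 (\<lambda>i. k * - y i) c = 1\<^sub>m n"
    "emat n 1 (\<lambda>i. k * - y i) c * emat n 1 (\<lambda>i. k * y i) c = 1\<^sub>m n"
    using beta by (simp_all add: emat_add_left emat_one_zero)
  moreover have "emat n 1 (\<lambda>i. k * - y i) c \<in> trvs n c d k"
    by (rule trvs.beta) (simp add: beta)
  ultimately show ?case by blast
next
  case (alpha f)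
  have "emat n 1 d (\<lambda>i. k * f i) * emat n 1 d (\<lambda>i. k * - f i) = 1\<^sub>m n"
    "emat n 1 d (\<lambda>i. k * - f i) * emat n 1 d (\<lambda>i. k * f i) = 1\<^sub>m n"
    using alpha by (simp_all add: emat_add_right emat_one_zero)
  moreover have "emat n 1 d (\<lambda>i. k * - f i) \<in> trvs n c d k"
    by (rule trvs.alpha) (simp add: alpha)
  ultimately show ?case by blast
qed

lemma trvs_betaI: "dot n c y = 0 \<Longrightarrow> (\<And>i. i < n \<Longrightarrow> u i = k * y i) \<Longrightarrow> emat n 1 u c \<in> trvs n c d k"
  using trvs.beta[of n c y k d] emat_cong[of n u c "\<lambda>i. k * y i" c 1] by simp

lemma trvs_alphaI: "dot n f d = 0 \<Longrightarrow> (\<And>i. i < n \<Longrightarrow> v i = k * f i) \<Longrightarrow> emat n 1 d v \<in> trvs n c d k"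
  using trvs.alpha[of n f d k c] emat_cong[of n d v d "\<lambda>i. k * f i" 1] by simp

lemma emat_commutator_trvs:
  assumes "dot n v' u = 0" "dot n v u = 0" "dot n v' u' = 0"
    and "emat n 1 u v \<in> trvs n c d k" "emat n 1 u' v' \<in> trvs n c d k"
    "emat n 1 (\<lambda>i. - u i) v \<in> trvs n c d k" "emat n 1 (\<lambda>i. - u' i) v' \<in> trvs n c d k"
  shows "emat n 1 (\<lambda>i. dot n v u' * u i) v' \<in> trvs n c d k"
  using emat_commutator[OF assms(1-3)] assms(4-) by (metis trvs.mult)

text \<open>The \<open>p i\<close> and \<open>q i\<close> become dual bases of the complement of \<open>d\<close> and its dual once \<open>s\<close> is inverted.\<close>
locale frame =
  fixes n :: nat and c d :: "nat \<Rightarrow> 'a::comm_ring_1" and p q :: "nat \<Rightarrow> nat \<Rightarrow> 'a" and I :: "nat set" and s :: 'a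
  assumes cd: "dot n c d = 1"
    and cp: "i \<in> I \<Longrightarrow> dot n c (p i) = 0"
    and qd: "i \<in> I \<Longrightarrow> dot n (q i) d = 0"
    and qp: "i \<in> I \<Longrightarrow> j \<in> I \<Longrightarrow> dot n (q i) (p j) = (if i = j then s else 0)"
    and fin: "finite I"
    and two: "i \<in> I \<Longrightarrow> \<exists>j\<in>I. j \<noteq> i"
    and span_p: "dot n c y = 0 \<Longrightarrow> k < n \<Longrightarrow> s * y k = (\<Sum>i\<in>I. dot n (q i) y * p i k)"
    and span_q: "dot n f d = 0 \<Longrightarrow> k < n \<Longrightarrow> s * f k = (\<Sum>i\<in>I. dot n f (p i) * q i k)"
begin

lemma dual: "frame n d c q p I s"
proof
  show "dot n d c = 1" using cd by (simp only: dot_commute)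
  show "dot n d (q i) = 0" if "i \<in> I" for i using qd[OF that] by (simp only: dot_commute)
  show "dot n (p i) c = 0" if "i \<in> I" for i using cp[OF that] by (simp only: dot_commute)
  show "dot n (p i) (q j) = (if i = j then s else 0)" if "i \<in> I" "j \<in> I" for i j
    using qp[OF that(2,1)] by (subst dot_commute) auto
  show "s * f k = (\<Sum>i\<in>I. dot n (p i) f * q i k)" if "dot n d f = 0" "k < n" for f k
    using span_q[of f k] that by (simp only: dot_commute[of n f d] dot_commute[of n f "p _"])
  show "s * y k = (\<Sum>i\<in>I. dot n y (q i) * p i k)" if "dot n y c = 0" "k < n" for y k
    using span_p[of y k] that by (simp only: dot_commute[of n c y] dot_commute[of n "q _" y])
qed (use fin two in auto)

end

text \<open>The commutator of the \<beta> with column k x and the \<alpha> with row k g. Since c d =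
  1, it has column k x and row k g, hence the factor k^2.\<close>

lemma dc_commutator:
  assumes "dot n c d = 1" "dot n c x = 0" "dot n g d = 0" "dot n g x = 0"
  shows "emat n 1 (\<lambda>i. k * k * x i) g \<in> trvs n c d k"
proof -
  have "emat n 1 (\<lambda>i. dot n c d * (k * x i)) (\<lambda>i. k * g i) \<in> trvs n c d k"
  proof (rule emat_commutator_trvs)
    show "emat n 1 (\<lambda>i. - (k * x i)) c \<in> trvs n c d k"
      by (rule trvs_betaI[where y = "\<lambda>i. - x i"]) (simp_all add: assms)
    have "emat n 1 d (\<lambda>i. - (k * g i)) \<in> trvs n c d k"
      by (rule trvs_alphaI[where f = "\<lambda>i. - g i"]) (simp_all add: assms)
    then show "emat n 1 (\<lambda>i. - d i) (\<lambda>i. k * g i) \<in> trvs n c d k"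
      by (rule emat_in_cong) simp
  qed (use assms in \<open>auto intro: trvs.intros\<close>)
  then show ?thesis
    using assms(1) emat_cong[of n "\<lambda>i. k * x i" "\<lambda>i. k * g i" "\<lambda>i. k * k * x i" g 1]
    by (simp add: mult_ac)
qed

section \<open>Transvections with mixed rows and columns, and conjugates of generators\<close>

context frame begin

text \<open>With the column fixed, the row may be split: its part along \<open>c\<close> gives a
  \<beta>, the part \<open>f\<close> a commutator of generators.\<close>

lemma trv_orth:
  assumes "dot n c x = 0" "dot n f d = 0" "dot n f x = 0"
  shows "emat n 1 (\<lambda>i. k * k * x i) (\<lambda>i. a * c i - f i) \<in> trvs n c d k"
proof -
  have 1: "emat n 1 (\<lambda>i. k * k * x i) (\<lambda>i. a * c i) \<in> trvs n c d k"
  proof -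
    have "emat n 1 (\<lambda>i. k * (k * a * x i)) c \<in> trvs n c d k"
      by (rule trvs.beta) (simp add: assms)
    then show ?thesis
      by (rule emat_in_cong) (simp add: mult_ac)
  qed
  have 2: "emat n 1 (\<lambda>i. k * k * x i) (\<lambda>i. - f i) \<in> trvs n c d k"
    by (rule dc_commutator) (simp_all add: assms cd)
  have "emat n 1 (\<lambda>i. k * k * x i) (\<lambda>i. a * c i) * emat n 1 (\<lambda>i. k * k * x i) (\<lambda>i. - f i)
     = emat n 1 (\<lambda>i. k * k * x i) (\<lambda>i. a * c i + - f i)"
    by (rule emat_add_right) (simp add: assms)
  then show ?thesis using trvs.mult[OF 1 2] by simp
qed

text \<open>The case of a conjugate with y along \<open>p i\<close> and f along \<open>q i\<close>.
  A second index \<open>j\<close> separates column from row: one factor has this column and row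
  \<open>q j\<close>, the other has column \<open>p j\<close> and this row. Their commutator
  acquires the factor \<open>s\<close> from the product of \<open>q j\<close> and
  \<open>p j\<close>, and k^2 from each factor.\<close>

lemma trv_basis:
  assumes i: "i \<in> I"
  shows "emat n 1 (\<lambda>x. k^4 * s * l * (s * p i x + b * d x)) (\<lambda>x. s\<^sup>2 * c x - b * q i x) \<in> trvs n c d k"
proof -
  obtain j where j: "j \<in> I" "j \<noteq> i" using two[OF i] by blast
  define u where "u m = (\<lambda>x. k * k * m * (s * p i x + b * d x))" for m
  have U: "emat n 1 (u m) (q j) \<in> trvs n c d k" for m
  proof -
    have "emat n 1 (\<lambda>x. k * k * (m * s * p i x)) (q j) \<in> trvs n c d k"
      by (rule dc_commutator) (use i j in \<open>simp_all add: cp qd qp cd\<close>)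
    moreover have "emat n 1 (\<lambda>x. k * k * m * b * d x) (q j) \<in> trvs n c d k"
    proof -
      have "emat n 1 d (\<lambda>x. k * (k * m * b * q j x)) \<in> trvs n c d k"
        by (rule trvs.alpha) (simp add: qd j)
      then show ?thesis
        using emat_cong[of n "\<lambda>x. k * k * m * b * d x" "q j" d "\<lambda>x. k * (k * m * b * q j x)" 1]
        by (simp add: mult_ac)
    qed
    moreover have "emat n 1 (\<lambda>x. k * k * (m * s * p i x)) (q j) * emat n 1 (\<lambda>x. k * k * m * b * d x) (q j)
       = emat n 1 (u m) (q j)"
      by (subst emat_add_left) (use j in \<open>simp_all add: qd u_def algebra_simps\<close>)
    ultimately show ?thesis by (metis trvs.mult)
  qed
  define v where "v m = (\<lambda>x. k * k * (m * p j x))" for m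
  have V: "emat n 1 (v m) (\<lambda>x. s\<^sup>2 * c x - b * q i x) \<in> trvs n c d k" for m
    unfolding v_def by (rule trv_orth) (use i j in \<open>simp_all add: cp qd qp cd\<close>)
  have "emat n 1 (\<lambda>x. dot n (q j) (v 1) * u l x) (\<lambda>x. s\<^sup>2 * c x - b * q i x) \<in> trvs n c d k"
  proof (rule emat_commutator_trvs)
    have "(\<lambda>x. - u l x) = u (- l)" "(\<lambda>x. - v 1 x) = v (- 1)"
      by (auto simp: u_def v_def)
    then show "emat n 1 (\<lambda>x. - u l x) (q j) \<in> trvs n c d k"
      "emat n 1 (\<lambda>x. - v 1 x) (\<lambda>x. s\<^sup>2 * c x - b * q i x) \<in> trvs n c d k"
      using U V by simp_all
    show "dot n (\<lambda>x. s\<^sup>2 * c x - b * q i x) (u l) = 0"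
      using i by (simp add: u_def cp qd qp cd algebra_simps power2_eq_square)
    show "dot n (\<lambda>x. s\<^sup>2 * c x - b * q i x) (v 1) = 0"
      using i j by (simp add: v_def cp qd qp cd)
    show "dot n (q j) (u l) = 0" using i j by (simp add: u_def cp qd qp cd)
  qed (use U V in auto)
  moreover have "dot n (q j) (v 1) * u l x = k^4 * s * l * (s * p i x + b * d x)" for x
    using j by (simp add: v_def u_def qp power4_eq_xxxx mult_ac)
  ultimately show ?thesis by simp
qed

text \<open>The part of \<open>f\<close> along \<open>q i\<close> is covered by
  \<open>trv_basis\<close>. The remainder, multiplied by \<open>s\<close> to avoid a division, is
  \<open>f1\<close>, which is orthogonal to \<open>p i\<close> and to \<open>d\<close>, so there the
  column may be split instead. The two rows add up to s (s c - f), whence one more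
  \<open>s\<close>.\<close>

lemma trv_basis_general:
  assumes i: "i \<in> I" and f: "dot n f d = 0"
  shows "emat n 1 (\<lambda>x. k^4 * s^2 * l * (s * p i x + dot n f (p i) * d x)) (\<lambda>x. s * c x - f x) \<in> trvs n c d k"
proof -
  define b where "b = dot n f (p i)"
  define u where "u = (\<lambda>x. k^4 * s * l * (s * p i x + b * d x))"
  define f1 where "f1 = (\<lambda>x. b * q i x - s * f x)"
  have f1: "dot n f1 (p i) = 0" "dot n f1 d = 0"
    using i by (simp_all add: f1_def b_def qp qd f mult.commute)
  have 1: "emat n 1 u (\<lambda>x. s\<^sup>2 * c x - b * q i x) \<in> trvs n c d k"
    unfolding u_def by (rule trv_basis[OF i])
  have 2: "emat n 1 u f1 \<in> trvs n c d k"
  proof -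
    have "emat n 1 (\<lambda>x. k * k * (k * k * s * l * s * p i x)) f1 \<in> trvs n c d k"
      by (rule dc_commutator) (use i f1 in \<open>simp_all add: cp cd\<close>)
    moreover have "emat n 1 (\<lambda>x. k^4 * s * l * b * d x) f1 \<in> trvs n c d k"
    proof -
      have "emat n 1 d (\<lambda>x. k * (k^3 * s * l * b * f1 x)) \<in> trvs n c d k"
        by (rule trvs.alpha) (simp add: f1)
      then show ?thesis
        using emat_cong[of n "\<lambda>x. k^4 * s * l * b * d x" f1 d "\<lambda>x. k * (k^3 * s * l * b * f1 x)" 1]
        by (simp add: mult_ac power4_eq_xxxx power3_eq_cube)
    qed
    moreover have "emat n 1 (\<lambda>x. k * k * (k * k * s * l * s * p i x)) f1 * emat n 1 (\<lambda>x. k^4 * s * l * b * d x) f1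
       = emat n 1 u f1"
      by (subst emat_add_left) (simp_all add: f1 u_def algebra_simps power4_eq_xxxx)
    ultimately show ?thesis by (metis trvs.mult)
  qed
  have "emat n 1 u (\<lambda>x. s\<^sup>2 * c x - b * q i x) * emat n 1 u f1
     = emat n 1 u (\<lambda>x. (s\<^sup>2 * c x - b * q i x) + f1 x)"
    by (rule emat_add_right) (use i in \<open>simp add: u_def cp qd qp cd algebra_simps power2_eq_square\<close>)
  also have "\<dots> = emat n 1 (\<lambda>x. k^4 * s^2 * l * (s * p i x + b * d x)) (\<lambda>x. s * c x - f x)"
    by (rule emat_cong) (simp add: u_def f1_def algebra_simps power2_eq_square)
  finally show ?thesis using trvs.mult[OF 1 2] by (simp add: b_def)
qed

lemma emat_sum_trvs:
  assumes "finite A" "\<And>i. i \<in> A \<Longrightarrow> dot n g (u i) = 0" "\<And>i. i \<in> A \<Longrightarrow> emat n 1 (u i) g \<in> trvs n c d k"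
  shows "emat n 1 (\<lambda>x. \<Sum>i\<in>A. u i x) g \<in> trvs n c d k"
  using assms
proof (induction A rule: finite_induct)
  case empty
  then show ?case by (simp add: emat_one_zero trvs.one)
next
  case (insert a A)
  have "emat n 1 (u a) g * emat n 1 (\<lambda>x. \<Sum>i\<in>A. u i x) g = emat n 1 (\<lambda>x. u a x + (\<Sum>i\<in>A. u i x)) g"
    by (rule emat_add_left) (use insert in \<open>simp add: dot_sum_right\<close>)
  moreover have "emat n 1 (u a) g * emat n 1 (\<lambda>x. \<Sum>i\<in>A. u i x) g \<in> trvs n c d k"
    using insert by (intro trvs.mult) auto
  ultimately show ?case using insert by simp
qed

text \<open>Transvections with the common row s c - f multiply by adding their columns. Adding those
  of \<open>trv_basis_general\<close> with the coefficients of s y in the \<open>p i\<close>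
  produces the required column.\<close>

lemma conjugate_in_trvs:
  assumes y: "dot n c y = 0" and f: "dot n f d = 0"
  shows "emat n 1 (\<lambda>x. k^4 * s^3 * (s * y x + dot n f y * d x)) (\<lambda>x. s * c x - f x) \<in> trvs n c d k"
proof -
  define u where "u i = (\<lambda>x. k^4 * s^2 * dot n (q i) y * (s * p i x + dot n f (p i) * d x))" for i
  have "emat n 1 (\<lambda>x. \<Sum>i\<in>I. u i x) (\<lambda>x. s * c x - f x) \<in> trvs n c d k"
  proof (rule emat_sum_trvs[OF fin])
    fix i assume i: "i \<in> I"
    show "dot n (\<lambda>x. s * c x - f x) (u i) = 0"
      using i by (simp add: u_def cp cd f)
    show "emat n 1 (u i) (\<lambda>x. s * c x - f x) \<in> trvs n c d k"
      unfolding u_def by (rule trv_basis_general[OF i f])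
  qed
  moreover have "(\<Sum>i\<in>I. u i x) = k^4 * s^3 * (s * y x + dot n f y * d x)" if "x < n" for x
  proof -
    have 1: "(\<Sum>i\<in>I. dot n (q i) y * p i x) = s * y x" using span_p[OF y that] by simp
    have "(\<Sum>i\<in>I. dot n (q i) y * dot n f (p i)) = dot n f (\<lambda>x. \<Sum>i\<in>I. dot n (q i) y * p i x)"
      by (simp add: dot_sum_right)
    also have "\<dots> = dot n f (\<lambda>x. s * y x)" by (rule dot_cong) (simp_all add: span_p[OF y])
    finally have 2: "(\<Sum>i\<in>I. dot n (q i) y * dot n f (p i)) = s * dot n f y" by simp
    have "(\<Sum>i\<in>I. u i x) = k^4 * s^2 * (s * (\<Sum>i\<in>I. dot n (q i) y * p i x)
        + (\<Sum>i\<in>I. dot n (q i) y * dot n f (p i)) * d x)"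
      by (simp add: u_def sum_distrib_left sum_distrib_right algebra_simps sum.distrib)
    then show ?thesis unfolding 1 2 by (simp add: algebra_simps power2_eq_square power3_eq_cube)
  qed
  ultimately show ?thesis
    using emat_cong[of n "\<lambda>x. \<Sum>i\<in>I. u i x" "\<lambda>x. s * c x - f x"
      "\<lambda>x. k^4 * s^3 * (s * y x + dot n f y * d x)" "\<lambda>x. s * c x - f x" 1] by simp
qed

lemma conj_alpha_beta:
  assumes y: "dot n c y = 0" and f: "dot n f d = 0"
  shows "\<exists>h \<in> trvs n c d k. h * emat n s d f = emat n s d f * emat n 1 (\<lambda>x. k^4 * s^5 * y x) c"
proof (rule bexI[OF _ conjugate_in_trvs[OF y f, of k]])
  show "emat n 1 (\<lambda>x. k^4 * s^3 * (s * y x + dot n f y * d x)) (\<lambda>x. s * c x - f x) * emat n s d f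
     = emat n s d f * emat n 1 (\<lambda>x. k^4 * s^5 * y x) c"
    unfolding emat_mult using y f
    by (intro eq_matI) (auto simp: cd algebra_simps eval_nat_numeral)
qed

lemma conj_beta_alpha:
  assumes y: "dot n c y = 0" and f: "dot n f d = 0"
  shows "\<exists>h \<in> trvs n c d k. h * emat n s y c = emat n s y c * emat n 1 d (\<lambda>x. k^4 * s^5 * f x)"
proof
  \<comment> \<open>Transposition reverses products and so would yield conjugation by the inverse
    matrix; \<open>- y x\<close> in place of \<open>y x\<close> compensates for this.\<close>
  have "emat n 1 (\<lambda>x. k^4 * s^3 * (s * f x + dot n (\<lambda>x. - y x) f * c x)) (\<lambda>x. s * d x - - y x) \<in> trvs n d c k"
    by (rule frame.conjugate_in_trvs[OF dual]) (use y f in \<open>simp_all add: dot_commute\<close>)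
  from trvs_transpose[OF this]
  show "emat n 1 (\<lambda>x. s * d x + y x) (\<lambda>x. k^4 * s^3 * (s * f x - dot n f y * c x)) \<in> trvs n c d k"
    by (simp add: transpose_emat dot_commute[of n y])
  show "emat n 1 (\<lambda>x. s * d x + y x) (\<lambda>x. k^4 * s^3 * (s * f x - dot n f y * c x)) * emat n s y c
     = emat n s y c * emat n 1 d (\<lambda>x. k^4 * s^5 * f x)"
    unfolding emat_mult using y f
    by (intro eq_matI) (auto simp: cd algebra_simps eval_nat_numeral)
qed

end

section \<open>Words in generators with denominators\<close>

lemma assoc_sq:
  "A \<in> carrier_mat n n \<Longrightarrow> B \<in> carrier_mat n n \<Longrightarrow> C \<in> carrier_mat n n \<Longrightarrow> A * B * C = A * (B * C)"
  by (rule assoc_mult_mat)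

text \<open>\<open>q j\<close> is the \<open>j\<close>-th coordinate, corrected to vanish on
  \<open>d\<close>. \<open>p j\<close> is \<open>c i0 * r\<close> times the \<open>j\<close>-th unit
  vector, with coordinate \<open>i0\<close> adjusted to lie in the kernel of \<open>c\<close>. The
  factor \<open>r\<close> makes any multiple of \<open>c i0\<close> available as \<open>s\<close>,
  and 3 \<le> n leaves two indices besides \<open>i0\<close>.\<close>

lemma frame_exists:
  fixes c d :: "nat \<Rightarrow> 'a::comm_ring_1"
  assumes cd: "dot n c d = 1" and i0: "i0 < n" and n: "3 \<le> n"
  shows "\<exists>p q. frame n c d p q ({..<n} - {i0}) (c i0 * r)"
proof -
  define p where "p j = (\<lambda>x. r * ((if x = j then c i0 else 0) - (if x = i0 then c j else 0)))" for j
  define q where "q j = (\<lambda>x. (if x = j then 1 else 0) - d j * c x)" for j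
  have unit: "dot n f (\<lambda>x. if x = j then a else 0) = f j * a"
    "dot n (\<lambda>x. if x = j then a else 0) f = a * f j" if "j < n" for f j a
    using that by (auto simp: dot_def if_distrib if_distribR sum.delta cong: if_cong)
  have fp: "dot n f (p j) = r * (f j * c i0 - f i0 * c j)" if "j < n" for f j
    using that i0 by (simp add: p_def unit)
  have qf: "dot n (q j) f = f j - d j * dot n c f" if "j < n" for f j
    using that by (simp add: q_def unit)
  have "frame n c d p q ({..<n} - {i0}) (c i0 * r)"
  proof
    show "dot n c d = 1" by fact
    show "dot n c (p i) = 0" if "i \<in> {..<n} - {i0}" for i
      using that by (simp add: fp mult.commute)
    show "dot n (q i) d = 0" if "i \<in> {..<n} - {i0}" for i
      using that by (simp add: qf cd)
    show "dot n (q i) (p j) = (if i = j then c i0 * r else 0)"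
      if "i \<in> {..<n} - {i0}" "j \<in> {..<n} - {i0}" for i j
    proof -
      have "dot n c (p j) = 0" "p j i = (if i = j then c i0 * r else 0)"
        using that by (simp_all add: fp) (auto simp: p_def mult.commute)
      then show ?thesis using that by (simp add: qf)
    qed
    show "\<exists>j\<in>{..<n} - {i0}. j \<noteq> i" if "i \<in> {..<n} - {i0}" for i
    proof -
      have "\<not> {..<n} \<subseteq> {i, i0}"
        using n card_mono[of "{i, i0}" "{..<n}"] by (auto simp: card_insert_if split: if_splits)
      then show ?thesis by blast
    qed
    show "c i0 * r * y k = (\<Sum>i\<in>{..<n} - {i0}. dot n (q i) y * p i k)" if y: "dot n c y = 0" and k: "k < n" for y k
    proof -
      have cy: "(\<Sum>i\<in>{..<n} - {i0}. c i * y i) = - (c i0 * y i0)"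
        using y i0 by (simp add: dot_def sum_diff1 )
      have "(\<Sum>i\<in>{..<n} - {i0}. dot n (q i) y * p i k) = (\<Sum>i\<in>{..<n} - {i0}. y i * p i k)"
        by (rule sum.cong) (simp_all add: qf y)
      also have "\<dots> = c i0 * r * y k"
      proof (cases "k = i0")
        case True
        then have "(\<Sum>i\<in>{..<n} - {i0}. y i * p i k) = (\<Sum>i\<in>{..<n} - {i0}. - r * (c i * y i))"
          by (intro sum.cong) (auto simp: p_def mult_ac)
        also have "\<dots> = - r * (\<Sum>i\<in>{..<n} - {i0}. c i * y i)" by (simp only: sum_distrib_left)
        also have "\<dots> = c i0 * r * y k" unfolding cy using True by (simp add: mult_ac)
        finally show ?thesis .
      next
        case False
        then have "(\<Sum>i\<in>{..<n} - {i0}. y i * p i k) = (\<Sum>i\<in>{..<n} - {i0}. if i = k then c i0 * r * y k else 0)"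
          by (intro sum.cong) (auto simp: p_def mult_ac)
        then show ?thesis using False k by (simp add: sum.delta)
      qed
      finally show ?thesis by simp
    qed
    show "c i0 * r * f k = (\<Sum>i\<in>{..<n} - {i0}. dot n f (p i) * q i k)" if f: "dot n f d = 0" and k: "k < n" for f k
    proof -
      \<comment> \<open>The summand at \<open>i0\<close> would be 0, so the sum runs over all
        indices and becomes a difference of two products. It is applied to a unit vector and to
        \<open>d\<close>.\<close>
      have e1: "(\<Sum>i\<in>{..<n} - {i0}. (f i * c i0 - f i0 * c i) * h i) = c i0 * dot n f h - f i0 * dot n c h" for h
        using i0 by (simp add: dot_def sum_diff1 left_diff_distrib sum_subtractf sum_distrib_left algebra_simps)
      have "(\<Sum>i\<in>{..<n} - {i0}. dot n f (p i) * q i k) = (\<Sum>i\<in>{..<n} - {i0}.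
          r * ((f i * c i0 - f i0 * c i) * (if i = k then 1 else 0)) - r * c k * ((f i * c i0 - f i0 * c i) * d i))"
        by (rule sum.cong) (auto simp: fp q_def algebra_simps)
      also have "\<dots> = r * (\<Sum>i\<in>{..<n} - {i0}. (f i * c i0 - f i0 * c i) * (if i = k then 1 else 0))
          - r * c k * (\<Sum>i\<in>{..<n} - {i0}. (f i * c i0 - f i0 * c i) * d i)"
        by (simp only: sum_subtractf sum_distrib_left)
      also have "\<dots> = c i0 * r * f k"
        unfolding e1 using k by (simp add: unit cd f algebra_simps)
      finally show ?thesis by simp
    qed
  qed auto
  then show ?thesis by blast
qed

text \<open>A pair \<open>(True, y)\<close> stands for \<open>\<beta>\<close>, a pair \<open>(False, f)\<close> for \<open>\<alpha>\<close>; \<open>gen_mat\<close> is \<open>s\<close> times the generator with parameter divided by \<open>s\<close>.\<close>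
definition gen_mat :: "nat \<Rightarrow> (nat \<Rightarrow> 'a::comm_ring_1) \<Rightarrow> (nat \<Rightarrow> 'a) \<Rightarrow> 'a \<Rightarrow> bool \<times> (nat \<Rightarrow> 'a) \<Rightarrow> 'a mat" where
  "gen_mat n c d s g = (if fst g then emat n s (snd g) c else emat n s d (snd g))"

definition gen_ok :: "nat \<Rightarrow> (nat \<Rightarrow> 'a::comm_ring_1) \<Rightarrow> (nat \<Rightarrow> 'a) \<Rightarrow> bool \<times> (nat \<Rightarrow> 'a) \<Rightarrow> bool" where
  "gen_ok n c d g = (if fst g then dot n c (snd g) = 0 else dot n (snd g) d = 0)"

definition gen_prod :: "nat \<Rightarrow> (nat \<Rightarrow> 'a::comm_ring_1) \<Rightarrow> (nat \<Rightarrow> 'a) \<Rightarrow> 'a \<Rightarrow> (bool \<times> (nat \<Rightarrow> 'a)) list \<Rightarrow> 'a mat" where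
  "gen_prod n c d s gs = foldr (\<lambda>g M. gen_mat n c d s g * M) gs (1\<^sub>m n)"

lemma gen_mat_carrier [simp]: "gen_mat n c d s g \<in> carrier_mat n n"
  by (simp add: gen_mat_def)

lemma gen_prod_Nil [simp]: "gen_prod n c d s [] = 1\<^sub>m n"
  and gen_prod_Cons [simp]: "gen_prod n c d s (g # gs) = gen_mat n c d s g * gen_prod n c d s gs"
  by (simp_all add: gen_prod_def)

lemma gen_prod_carrier [simp]: "gen_prod n c d s gs \<in> carrier_mat n n"
  by (induction gs) (auto intro: mult_carrier_mat[where n=n])

lemma gen_prod_append: "gen_prod n c d s (gs @ hs) = gen_prod n c d s gs * gen_prod n c d s hs"
  by (induction gs) (simp_all add: assoc_sq[of _ n] left_mult_one_mat[where nr=n and nc=n])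

lemma smult_sq:
  "A \<in> carrier_mat n n \<Longrightarrow> B \<in> carrier_mat n n \<Longrightarrow> (a \<cdot>\<^sub>m A) * B = a \<cdot>\<^sub>m (A * B)"
  "A \<in> carrier_mat n n \<Longrightarrow> B \<in> carrier_mat n n \<Longrightarrow> A * ((a::'a::comm_ring_1) \<cdot>\<^sub>m B) = a \<cdot>\<^sub>m (A * B)"
  by (simp_all add: mult_smult_distrib mult_smult_assoc_mat[of _ n n _ n])

lemma smult_smult_mat: "a \<cdot>\<^sub>m (b \<cdot>\<^sub>m A) = (a * b :: 'a::comm_ring_1) \<cdot>\<^sub>m A"
  by (rule eq_matI) (auto simp: mult.assoc)

lemma gen_mat_inverse:
  assumes "gen_ok n c d g"
  shows "\<exists>h. gen_ok n c d h \<and> gen_mat n c d s h * gen_mat n c d s g = s\<^sup>2 \<cdot>\<^sub>m 1\<^sub>m n"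
  using assms
  by (intro exI[of _ "(fst g, \<lambda>i. - snd g i)"])
     (auto simp: gen_ok_def gen_mat_def emat_mult power2_eq_square intro!: eq_matI)

text \<open>The reversed word with negated parameters: each letter contributes (s I - u v)(s I + u
  v) = s^2 I.\<close>

lemma gen_prod_inverse:
  assumes "\<forall>g\<in>set gs. gen_ok n c d g"
  shows "\<exists>hs e. (\<forall>g\<in>set hs. gen_ok n c d g) \<and> gen_prod n c d s hs * gen_prod n c d s gs = s^e \<cdot>\<^sub>m 1\<^sub>m n"
  using assms
proof (induction gs)
  case Nil
  show ?case by (rule exI[of _ "[]"], rule exI[of _ 0]) (auto intro!: eq_matI)
next
  case (Cons g gs)
  then obtain hs e where hs: "\<forall>g\<in>set hs. gen_ok n c d g" "gen_prod n c d s hs * gen_prod n c d s gs = s^e \<cdot>\<^sub>m 1\<^sub>m n"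
    by auto
  obtain h where h: "gen_ok n c d h" "gen_mat n c d s h * gen_mat n c d s g = s\<^sup>2 \<cdot>\<^sub>m 1\<^sub>m n"
    using gen_mat_inverse[of n c d g s] Cons.prems by auto
  have "gen_prod n c d s (hs @ [h]) * gen_prod n c d s (g # gs)
     = gen_prod n c d s hs * ((gen_mat n c d s h * gen_mat n c d s g) * gen_prod n c d s gs)"
    by (simp add: gen_prod_append assoc_sq[of _ n] mult_carrier_mat[where n=n] right_mult_one_mat[where nc=n and nr=n])
  also have "\<dots> = s^(e+2) \<cdot>\<^sub>m 1\<^sub>m n"
    by (simp add: h smult_sq[of _ n] hs smult_smult_mat power_add power2_eq_square mult_ac left_mult_one_mat[where nc=n and nr=n])
  finally show ?case using hs h by (intro exI[of _ "hs @ [h]"] exI[of _ "e+2"]) auto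
qed

section \<open>Moving group elements across a word\<close>

context frame begin

text \<open>Generators of the same kind commute, and mixed pairs are \<open>conj_alpha_beta\<close>
  and \<open>conj_beta_alpha\<close>. Having an intertwining partner passes to products, which gives
  all of the group.\<close>

lemma conj_trvs:
  assumes h: "h \<in> trvs n c d (k^4 * s^5)" and g: "gen_ok n c d g"
  shows "\<exists>h' \<in> trvs n c d k. h' * gen_mat n c d s g = gen_mat n c d s g * h"
  using h
proof (induction rule: trvs.induct)
  case one
  then show ?case by (intro bexI[of _ "1\<^sub>m n"] trvs.one) (simp add: left_mult_one_mat[where nr=n and nc=n] right_mult_one_mat[where nr=n and nc=n])
next
  case (mult h1 h2)
  let ?g = "gen_mat n c d s g"
  from mult obtain h1' h2' where
    h: "h1' \<in> trvs n c d k" "h1' * ?g = ?g * h1" "h2' \<in> trvs n c d k" "h2' * ?g = ?g * h2" by blast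
  note C = mult(1,2)[THEN trvs_carrier] h(1,3)[THEN trvs_carrier]
  have "h1' * h2' * ?g = h1' * (h2' * ?g)" using C by (simp add: assoc_sq)
  also have "\<dots> = (h1' * ?g) * h2" unfolding h(4) using C by (simp add: assoc_sq[of _ n])
  also have "\<dots> = ?g * (h1 * h2)" unfolding h(2) using C by (simp add: assoc_sq[of _ n])
  finally show ?case using h trvs.mult by blast
next
  case (beta y)
  show ?case
  proof (cases "fst g")
    case True
    let ?h = "emat n 1 (\<lambda>i. k^4 * s^5 * y i) c"
    have "?h \<in> trvs n c d k"
      by (rule trvs_dvd_mono[OF _ trvs.beta]) (simp_all add: beta dvd_mult2)
    moreover have "?h * gen_mat n c d s g = gen_mat n c d s g * ?h"
      using True g beta by (auto simp: gen_ok_def gen_mat_def emat_mult intro!: eq_matI)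
    ultimately show ?thesis by blast
  next
    case False
    then show ?thesis using conj_alpha_beta[OF beta, of "snd g" k] g by (simp add: gen_ok_def gen_mat_def)
  qed
next
  case (alpha f)
  show ?case
  proof (cases "fst g")
    case False
    let ?h = "emat n 1 d (\<lambda>i. k^4 * s^5 * f i)"
    have "?h \<in> trvs n c d k"
      by (rule trvs_dvd_mono[OF _ trvs.alpha]) (simp_all add: alpha dvd_mult2)
    moreover have "?h * gen_mat n c d s g = gen_mat n c d s g * ?h"
      using False g alpha by (auto simp: gen_ok_def gen_mat_def emat_mult intro!: eq_matI)
    ultimately show ?thesis by blast
  next
    case True
    then show ?thesis using conj_beta_alpha[OF _ alpha, of "snd g" k] g by (simp add: gen_ok_def gen_mat_def)
  qed
qed

text \<open>In the product with \<open>h\<close> the scalar part \<open>s\<close> of the letter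
  multiplies the parameter of \<open>h\<close>; this turns s^N into s^(N+1).\<close>

lemma gen_mat_deform:
  assumes w: "gen_ok n c d (b, w)" and w': "gen_ok n c d (b, w')"
    and z: "\<And>i. i < n \<Longrightarrow> w' i = w i + s^(N+1) * z i"
  shows "\<exists>h \<in> trvs n c d (s^N). gen_mat n c d s (b, w') = gen_mat n c d s (b, w) * h"
proof (cases b)
  case True
  \<comment> \<open>Orthogonality of \<open>w\<close> and \<open>w'\<close> to \<open>c\<close>
    yields only s^(N+1) (c z) = 0, and \<open>s\<close> may be a zero divisor. Removing the
    component along \<open>d\<close> makes c z' = 0 without changing s^(N+1) z.\<close>
  define z' where "z' = (\<lambda>i. z i - dot n c z * d i)"
  have "dot n c w' = dot n c (\<lambda>i. w i + s^(N+1) * z i)" by (rule dot_cong) (simp_all add: z)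
  then have 0: "s^(N+1) * dot n c z = 0" using w w' True by (simp add: gen_ok_def)
  have z': "dot n c z' = 0" by (simp add: z'_def cd)
  have eq: "w' i = w i + s^(N+1) * z' i" if "i < n" for i
  proof -
    have "s^(N+1) * z' i = s^(N+1) * z i - (s^(N+1) * dot n c z) * d i" by (simp only: z'_def right_diff_distrib mult.assoc)
    then show ?thesis using z[OF that] unfolding 0 by simp
  qed
  show ?thesis
  proof (rule bexI)
    show "emat n 1 (\<lambda>i. s^N * z' i) c \<in> trvs n c d (s^N)" by (rule trvs.beta[OF z'])
    show "gen_mat n c d s (b, w') = gen_mat n c d s (b, w) * emat n 1 (\<lambda>i. s^N * z' i) c"
      using True z' by (auto simp: gen_mat_def emat_mult eq algebra_simps intro!: eq_matI)
  qed
next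
  case False
  define z' where "z' = (\<lambda>i. z i - dot n z d * c i)"
  have "dot n w' d = dot n (\<lambda>i. w i + s^(N+1) * z i) d" by (rule dot_cong) (simp_all add: z)
  then have 0: "s^(N+1) * dot n z d = 0" using w w' False by (simp add: gen_ok_def)
  have z': "dot n z' d = 0" by (simp add: z'_def cd)
  have eq: "w' i = w i + s^(N+1) * z' i" if "i < n" for i
  proof -
    have "s^(N+1) * z' i = s^(N+1) * z i - (s^(N+1) * dot n z d) * c i" by (simp only: z'_def right_diff_distrib mult.assoc)
    then show ?thesis using z[OF that] unfolding 0 by simp
  qed
  show ?thesis
  proof (rule bexI)
    show "emat n 1 d (\<lambda>i. s^N * z' i) \<in> trvs n c d (s^N)" by (rule trvs.alpha[OF z'])
    show "gen_mat n c d s (b, w') = gen_mat n c d s (b, w) * emat n 1 d (\<lambda>i. s^N * z' i)"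
      using False w z' by (auto simp: gen_mat_def gen_ok_def emat_mult eq algebra_simps intro!: eq_matI)
  qed
qed

end

text \<open>Depending on the length of the word only, the exponent is uniform in the point \<open>a\<close> at which \<open>\<theta>\<close> is expanded.\<close>
fun deform_exp :: "nat \<Rightarrow> nat \<Rightarrow> nat" where
  "deform_exp 0 K = 0"
| "deform_exp (Suc l) K = max (4 * K + 5) (deform_exp l (4 * K + 5))"

text \<open>If the new first letter is g h and the new tail is H E, then h H must move to the left
  of g. This lowers level s^(4K+5) to s^K, which is the recursion of
  \<open>deform_exp\<close>.\<close>

lemma (in frame) gen_prod_deform:
  assumes "deform_exp (length ws) K \<le> N"
    and "\<And>b w w'. (b, w, w') \<in> set ws \<Longrightarrow> gen_ok n c d (b, w) \<and> gen_ok n c d (b, w') \<and>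
           (\<forall>i<n. s^(N+1) dvd w' i - w i)"
  shows "\<exists>H \<in> trvs n c d (s^K). gen_prod n c d s (map (\<lambda>(b,w,w'). (b,w')) ws)
           = H * gen_prod n c d s (map (\<lambda>(b,w,w'). (b,w)) ws)"
  using assms
proof (induction ws arbitrary: K)
  case Nil
  then show ?case by (intro bexI[of _ "1\<^sub>m n"]) (auto intro: trvs.one)
next
  case (Cons a ws)
  obtain b w w' where a: "a = (b, w, w')" by (cases a)
  let ?E = "gen_prod n c d s (map (\<lambda>(b,w,w'). (b,w)) ws)" and ?g = "gen_mat n c d s (b, w)"
  have k: "s^(4*K+5) = (s^K)^4 * s^5" by (simp add: power_add power_mult[symmetric] mult.commute)
  obtain H where H: "H \<in> trvs n c d (s^(4*K+5))" "gen_prod n c d s (map (\<lambda>(b,w,w'). (b,w')) ws) = H * ?E"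
    using Cons.IH[of "4*K+5"] Cons.prems by fastforce
  have "\<forall>i<n. \<exists>z. w' i = w i + s^(N+1) * z"
    using Cons.prems(2)[of b w w'] a by (force simp: dvd_def algebra_simps)
  then obtain z where z: "\<And>i. i < n \<Longrightarrow> w' i = w i + s^(N+1) * z i" by metis
  obtain h where h: "h \<in> trvs n c d (s^N)" "gen_mat n c d s (b, w') = ?g * h"
    using gen_mat_deform[of b w w' N z] z Cons.prems(2)[of b w w'] a by auto
  have "h \<in> trvs n c d (s^(4*K+5))"
    using Cons.prems(1) by (intro trvs_dvd_mono[OF _ h(1)] le_imp_power_dvd) simp
  then have hH: "h * H \<in> trvs n c d ((s^K)^4 * s^5)" using H(1) unfolding k by (rule trvs.mult)
  obtain H' where H': "H' \<in> trvs n c d (s^K)" "H' * ?g = ?g * (h * H)"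
    using conj_trvs[OF hH, of "(b, w)"] Cons.prems(2)[of b w w'] a by auto
  note C = trvs_carrier[OF h(1)] trvs_carrier[OF H(1)] trvs_carrier[OF H'(1)]
  have "gen_prod n c d s (map (\<lambda>(b,w,w'). (b,w')) (a # ws)) = ?g * h * (H * ?E)"
    by (simp add: a h H)
  also have "\<dots> = (?g * (h * H)) * ?E"
    using C by (simp add: assoc_sq[of _ n] mult_carrier_mat[where n=n])
  also have "\<dots> = H' * gen_prod n c d s (map (\<lambda>(b,w,w'). (b,w)) (a # ws))"
    using C by (simp add: a flip: H'(2)) (simp add: assoc_sq[of _ n])
  finally show ?case using H'(1) by blast
qed

section \<open>Functoriality under ring homomorphisms\<close>

context comm_ring_hom begin

lemma hom_dot: "hom (dot n u v) = dot n (\<lambda>i. hom (u i)) (\<lambda>i. hom (v i))"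
  by (simp add: dot_def hom_distribs)

lemma map_mat_emat: "map_mat hom (emat n s u v) = emat n (hom s) (\<lambda>i. hom (u i)) (\<lambda>i. hom (v i))"
  by (rule eq_matI) (auto simp: hom_distribs)

lemma map_mat_smult: "map_mat hom (a \<cdot>\<^sub>m A) = hom a \<cdot>\<^sub>m map_mat hom A"
  by (rule eq_matI) (auto simp: hom_distribs)

lemma map_mat_one: "map_mat hom (1\<^sub>m n) = 1\<^sub>m n"
  by (rule eq_matI) auto

lemma trvs_hom:
  "g \<in> trvs n c d k \<Longrightarrow> map_mat hom g \<in> trvs n (\<lambda>i. hom (c i)) (\<lambda>i. hom (d i)) (hom k)"
proof (induction rule: trvs.induct)
  case (mult g h)
  then show ?case
    by (simp add: mat_hom_mult[OF trvs_carrier[OF mult(1)] trvs_carrier[OF mult(2)]] trvs.mult)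
next
  case (beta y)
  then have "dot n (\<lambda>i. hom (c i)) (\<lambda>i. hom (y i)) = 0" by (simp flip: hom_dot)
  then show ?case by (simp add: map_mat_emat hom_mult trvs.beta)
next
  case (alpha f)
  then have "dot n (\<lambda>i. hom (f i)) (\<lambda>i. hom (d i)) = 0" by (simp flip: hom_dot)
  then show ?case by (simp add: map_mat_emat hom_mult trvs.alpha)
qed (simp add: map_mat_one trvs.one)

lemma gen_prod_hom:
  "map_mat hom (gen_prod n c d s gs) = gen_prod n (\<lambda>i. hom (c i)) (\<lambda>i. hom (d i)) (hom s)
     (map (\<lambda>(b,w). (b, \<lambda>i. hom (w i))) gs)"
  by (induction gs) (auto simp: mat_hom_mult[of _ n n _ n] map_mat_one gen_mat_def map_mat_emat)

lemma gen_ok_hom: "gen_ok n c d g \<Longrightarrow> gen_ok n (\<lambda>i. hom (c i)) (\<lambda>i. hom (d i)) (fst g, \<lambda>i. hom (snd g i))"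
  by (auto simp: gen_ok_def simp flip: hom_dot)

end

section \<open>Substitutions in polynomials\<close>

text \<open>The substitution is prescribed on monomials rather than on variables: both uses, by
  degree and by the set of variables occurring, have a direct description there.\<close>

definition mpoly_eval :: "('a::comm_ring_1 \<Rightarrow> 'b::comm_ring_1) \<Rightarrow> ((nat \<Rightarrow>\<^sub>0 nat) \<Rightarrow> 'b) \<Rightarrow> 'a mpoly \<Rightarrow> 'b" where
  "mpoly_eval h x p = (\<Sum>m\<in>Poly_Mapping.keys p. h (Poly_Mapping.lookup p m) * x m)"

lemma mpoly_sum_monomials:
  "p = (\<Sum>m\<in>Poly_Mapping.keys p. Poly_Mapping.single m (Poly_Mapping.lookup p m))"
  by (rule poly_mapping_eqI)
     (auto simp: lookup_sum lookup_single when_def sum.delta' in_keys_iff)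

lemma (in comm_ring_hom) mpoly_eval_hom:
  assumes one: "x 0 = 1" and mult: "\<And>m m'. x (m + m') = x m * x m'"
  shows "comm_ring_hom (mpoly_eval hom x)"
proof -
  have single: "mpoly_eval hom x (Poly_Mapping.single m a) = hom a * x m" for m a
    by (simp add: mpoly_eval_def)
  have add: "mpoly_eval hom x (p + q) = mpoly_eval hom x p + mpoly_eval hom x q" for p q
    unfolding mpoly_eval_def
    by (rule setsum_keys_plus_distrib) (simp_all add: hom_distribs distrib_right)
  have zero: "mpoly_eval hom x 0 = 0" by (simp add: mpoly_eval_def)
  have sum2: "mpoly_eval hom x (\<Sum>i\<in>A. \<Sum>j\<in>B. f i j) = (\<Sum>i\<in>A. \<Sum>j\<in>B. mpoly_eval hom x (f i j))"
    for A B :: "(nat \<Rightarrow>\<^sub>0 nat) set" and f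
  proof -
    have sum': "mpoly_eval hom x (\<Sum>i\<in>A. f i) = (\<Sum>i\<in>A. mpoly_eval hom x (f i))" for A :: "(nat \<Rightarrow>\<^sub>0 nat) set" and f
      by (induction A rule: infinite_finite_induct) (simp_all add: add zero)
    show ?thesis by (simp add: sum')
  qed
  have "mpoly_eval hom x (p * q) = mpoly_eval hom x p * mpoly_eval hom x q" for p q
  proof -
    have "p * q = (\<Sum>m\<in>Poly_Mapping.keys p. \<Sum>m'\<in>Poly_Mapping.keys q.
        Poly_Mapping.single (m + m') (Poly_Mapping.lookup p m * Poly_Mapping.lookup q m'))"
      by (subst mpoly_sum_monomials[of p], subst mpoly_sum_monomials[of q]) (simp add: sum_product mult_single)
    then have "mpoly_eval hom x (p * q) = (\<Sum>m\<in>Poly_Mapping.keys p. \<Sum>m'\<in>Poly_Mapping.keys q.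
        (hom (Poly_Mapping.lookup p m) * x m) * (hom (Poly_Mapping.lookup q m') * x m'))"
      by (simp only: sum2 single hom_mult mult mult_ac)
    then show ?thesis by (simp add: mpoly_eval_def sum_product)
  qed
  moreover have "mpoly_eval hom x 1 = 1"
    using single[of 0 1] by (simp add: one)
  ultimately show ?thesis by unfold_locales (simp_all add: add zero)
qed

lemma mpoly_eval_cst: "h 0 = 0 \<Longrightarrow> x 0 = 1 \<Longrightarrow> mpoly_eval h x (cst a) = h a"
  by (simp add: mpoly_eval_def cst_def)

lemma cst_mult_monomial: "cst a * Poly_Mapping.single m 1 = Poly_Mapping.single m a"
  by (simp add: cst_def mult_single)

lemma cst_hom: "comm_ring_hom (cst :: 'a::comm_ring_1 \<Rightarrow> 'a mpoly)"
  by unfold_locales (auto simp: cst_def single_add mult_single)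

lemma poly_eval_hom: "comm_ring_hom (\<lambda>p. poly p (x :: 'a::comm_ring_1))"
  by unfold_locales auto

lemma poly_const_hom: "comm_ring_hom (\<lambda>a::'a::comm_ring_1. [:a:])"
  by unfold_locales (auto simp: one_pCons)

lemma comm_ring_hom_comp:
  assumes "comm_ring_hom f" "comm_ring_hom g" shows "comm_ring_hom (\<lambda>x. f (g x))"
proof -
  interpret f: comm_ring_hom f by fact
  interpret g: comm_ring_hom g by fact
  show ?thesis by unfold_locales (simp_all add: f.hom_add g.hom_add f.hom_mult g.hom_mult)
qed

definition mon_degree :: "(nat \<Rightarrow>\<^sub>0 nat) \<Rightarrow> nat" where
  "mon_degree m = (\<Sum>i\<in>Poly_Mapping.keys m. Poly_Mapping.lookup m i)"

lemma mon_degree_zero [simp]: "mon_degree 0 = 0"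
  by (simp add: mon_degree_def)

lemma mon_degree_add: "mon_degree (m + m') = mon_degree m + mon_degree m'"
  unfolding mon_degree_def by (rule setsum_keys_plus_distrib) simp_all

lemma mon_degree_eq_0: "mon_degree m = 0 \<longleftrightarrow> m = 0"
  by (auto simp: mon_degree_def in_keys_iff intro: poly_mapping_eqI)

text \<open>The substitution \<open>X \<mapsto> T X\<close>, the polynomial variable being \<open>T\<close>.\<close>
definition homogenize :: "'a::comm_ring_1 mpoly \<Rightarrow> 'a mpoly poly" where
  "homogenize = mpoly_eval (\<lambda>a. [:cst a:]) (\<lambda>m. monom (Poly_Mapping.single m 1) (mon_degree m))"

lemma homogenize_hom: "comm_ring_hom (homogenize :: 'a::comm_ring_1 mpoly \<Rightarrow> _)"
  unfolding homogenize_def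
  by (rule comm_ring_hom.mpoly_eval_hom[OF comm_ring_hom_comp[OF poly_const_hom cst_hom]])
     (simp_all add: mult_monom mult_single mon_degree_add monom_0 one_pCons)

lemma homogenize_cst: "homogenize (cst a) = [:cst a:]"
  unfolding homogenize_def
  by (subst mpoly_eval_cst) (simp_all add: monom_0 one_pCons cst_def)

lemma poly_homogenize_1: "poly (homogenize p) 1 = p"
  by (simp add: homogenize_def mpoly_eval_def poly_sum poly_monom cst_mult_monomial flip: mpoly_sum_monomials)

lemma poly_homogenize_0: "poly (homogenize p) 0 = cst (Poly_Mapping.lookup p 0)"
proof -
  have "poly (homogenize p) 0 = (\<Sum>m\<in>Poly_Mapping.keys p. if m = 0 then cst (Poly_Mapping.lookup p 0) else 0)"
    unfolding homogenize_def mpoly_eval_def poly_sum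
    by (rule sum.cong) (auto simp: poly_monom power_0_left mon_degree_eq_0)
  also have "\<dots> = cst (Poly_Mapping.lookup p 0)"
    by (auto simp: sum.delta in_keys_iff cst_def)
  finally show ?thesis .
qed

text \<open>The retraction that puts 0 for every variable with index at least \<open>t\<close>.
  Patching is done with all variables present, and its result is projected at the end.\<close>

definition truncate_vars :: "nat \<Rightarrow> 'a::comm_ring_1 mpoly \<Rightarrow> 'a mpoly" where
  "truncate_vars t = mpoly_eval cst (\<lambda>m. if Poly_Mapping.keys m \<subseteq> {..<t} then Poly_Mapping.single m 1 else 0)"

lemma keys_add_mon: "Poly_Mapping.keys (m + m') = Poly_Mapping.keys m \<union> Poly_Mapping.keys (m' :: nat \<Rightarrow>\<^sub>0 nat)"
  by (auto simp: in_keys_iff lookup_add)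

lemma truncate_vars_hom: "comm_ring_hom (truncate_vars t)"
  unfolding truncate_vars_def
  by (rule comm_ring_hom.mpoly_eval_hom[OF cst_hom]) (auto simp: keys_add_mon mult_single)

lemma truncate_vars_cst: "truncate_vars t (cst a) = cst a"
  unfolding truncate_vars_def by (subst mpoly_eval_cst) (simp_all add: cst_def)

lemma truncate_vars_in: "truncate_vars t p \<in> polys_in t"
proof -
  have "Poly_Mapping.keys (truncate_vars t p) \<subseteq> (\<Union>m\<in>Poly_Mapping.keys p. Poly_Mapping.keys (cst (Poly_Mapping.lookup p m) * (if Poly_Mapping.keys m \<subseteq> {..<t} then Poly_Mapping.single m 1 else 0)))"
    unfolding truncate_vars_def mpoly_eval_def by (rule keys_sum)
  also have "\<dots> \<subseteq> {m. Poly_Mapping.keys m \<subseteq> {..<t}}"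
    by (auto simp: cst_mult_monomial split: if_splits)
  finally show ?thesis by (auto simp: polys_in_def)
qed

lemma truncate_vars_id: "p \<in> polys_in t \<Longrightarrow> truncate_vars t p = p"
proof -
  assume "p \<in> polys_in t"
  then have "truncate_vars t p = (\<Sum>m\<in>Poly_Mapping.keys p. Poly_Mapping.single m (Poly_Mapping.lookup p m))"
    unfolding truncate_vars_def mpoly_eval_def
    by (intro sum.cong) (auto simp: polys_in_def cst_mult_monomial)
  then show ?thesis using mpoly_sum_monomials[of p] by simp
qed

section \<open>Maximal ideals and localisation\<close>

lemma maximal_ideal_exists:
  fixes J :: "'a::comm_ring_1 set"
  assumes "is_ideal J" "J \<noteq> UNIV"
  shows "\<exists>m. maximal_ideal m \<and> J \<subseteq> m"
proof -
  define P where "P = {A. is_ideal A \<and> J \<subseteq> A \<and> (1::'a) \<notin> A}"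
  have proper: "A \<noteq> UNIV \<longleftrightarrow> 1 \<notin> A" if "is_ideal A" for A :: "'a set"
    using that unfolding is_ideal_def by (metis UNIV_I UNIV_eq_I mult.right_neutral)
  have "\<exists>M\<in>P. \<forall>X\<in>P. M \<subseteq> X \<longrightarrow> X = M"
  proof (rule subset_Zorn_nonempty)
    show "P \<noteq> {}" using assms proper unfolding P_def by auto
    fix C assume C: "C \<noteq> {}" "subset.chain P C"
    have CP: "A \<in> P" if "A \<in> C" for A using C(2) that by (auto simp: subset.chain_def)
    have tot: "A \<subseteq> B \<or> B \<subseteq> A" if "A \<in> C" "B \<in> C" for A B
      using C(2) that unfolding subset.chain_def by blast
    have "is_ideal (\<Union>C)"
      unfolding is_ideal_def
    proof (intro conjI ballI allI impI)
      show "0 \<in> \<Union>C" using C(1) CP unfolding P_def is_ideal_def by blast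
      fix x y assume "x \<in> \<Union>C" "y \<in> \<Union>C"
      then obtain A B where "A \<in> C" "x \<in> A" "B \<in> C" "y \<in> B" by blast
      with tot[of A B] have "\<exists>D\<in>C. x \<in> D \<and> y \<in> D" by blast
      then show "x + y \<in> \<Union>C" using CP unfolding P_def is_ideal_def by blast
    next
      fix r x assume "x \<in> \<Union>C"
      then show "r * x \<in> \<Union>C" using CP unfolding P_def is_ideal_def by blast
    qed
    then show "\<Union>C \<in> P" using C(1) CP unfolding P_def by blast
  qed
  then obtain M where M: "M \<in> P" "\<And>X. X \<in> P \<Longrightarrow> M \<subseteq> X \<Longrightarrow> X = M" by blast
  have "maximal_ideal M"
    unfolding maximal_ideal_def
  proof (intro conjI allI impI)
    show "is_ideal M" using M unfolding P_def by blast
    then show "M \<noteq> UNIV" using proper M unfolding P_def by blast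
    fix A assume A: "is_ideal A \<and> M \<subseteq> A"
    show "A = M \<or> A = UNIV"
    proof (rule ccontr)
      assume "\<not> (A = M \<or> A = UNIV)"
      then have "A \<in> P" using A M(1) proper[of A] unfolding P_def by blast
      then show False using M(2) A \<open>\<not> (A = M \<or> A = UNIV)\<close> by blast
    qed
  qed
  then show ?thesis using M(1) unfolding P_def by blast
qed

lemma maximal_ideal_prime:
  fixes m :: "'a::comm_ring_1 set"
  assumes m: "maximal_ideal m" and xy: "x * y \<in> m" and x: "x \<notin> m"
  shows "y \<in> m"
proof -
  have id: "is_ideal m" using m by (simp add: maximal_ideal_def)
  define A where "A = {z. \<exists>u r. u \<in> m \<and> z = u + r * x}"
  have "is_ideal A"
    unfolding is_ideal_def
  proof (intro conjI ballI allI impI)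
    show "0 \<in> A" using id unfolding A_def is_ideal_def by (intro CollectI exI[of _ 0]) auto
    fix a b assume "a \<in> A" "b \<in> A"
    then obtain u r u' r' where "u \<in> m" "a = u + r * x" "u' \<in> m" "b = u' + r' * x" unfolding A_def by blast
    then show "a + b \<in> A" using id unfolding A_def is_ideal_def
      by (intro CollectI exI[of _ "u + u'"] exI[of _ "r + r'"]) (auto simp: algebra_simps)
  next
    fix l a assume "a \<in> A"
    then obtain u r where "u \<in> m" "a = u + r * x" unfolding A_def by blast
    then show "l * a \<in> A" using id unfolding A_def is_ideal_def
      by (intro CollectI exI[of _ "l * u"] exI[of _ "l * r"]) (auto simp: algebra_simps)
  qed
  moreover have "m \<subseteq> A"
  proof
    fix z assume "z \<in> m" then show "z \<in> A" unfolding A_def by (intro CollectI exI[of _ z] exI[of _ 0]) simp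
  qed
  moreover have "x \<in> A" using id unfolding A_def is_ideal_def by (intro CollectI exI[of _ 0] exI[of _ 1]) auto
  ultimately have "A = UNIV" using m x unfolding maximal_ideal_def by blast
  then obtain u r where u: "u \<in> m" "1 = u + r * x" unfolding A_def by blast
  have "y = y * (u + r * x)" using u(2) by simp
  also have "\<dots> = y * u + r * (x * y)" by (simp add: algebra_simps)
  finally show ?thesis using id u(1) xy unfolding is_ideal_def by metis
qed

lemma maximal_ideal_one: "maximal_ideal m \<Longrightarrow> 1 \<notin> (m :: 'a::comm_ring_1 set)"
  unfolding maximal_ideal_def is_ideal_def by (metis UNIV_eq_I mult.right_neutral)

lemma maximal_ideal_power: "maximal_ideal m \<Longrightarrow> (x :: 'a::comm_ring_1) \<notin> m \<Longrightarrow> x ^ e \<notin> m"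
  by (induction e) (auto simp: maximal_ideal_one dest: maximal_ideal_prime)

lemma ideal_sum: "is_ideal m \<Longrightarrow> (\<And>i. i \<in> A \<Longrightarrow> f i \<in> m) \<Longrightarrow> sum f A \<in> (m :: 'a::comm_ring_1 set)"
  by (induction A rule: infinite_finite_induct) (auto simp: is_ideal_def)

text \<open>The values of q at a + r T and at a agree modulo r. This supplies the divisibility
  required in \<open>gen_prod_deform\<close>.\<close>

lemma poly_dvd_diff_eval:
  fixes q :: "'a::comm_ring_1 poly"
  shows "[:r:] dvd pcompose q [:a, r:] - [:poly q a:]"
proof (induction q)
  case 0
  then show ?case by simp
next
  case (pCons x q)
  have "pcompose (pCons x q) [:a, r:] - [:poly (pCons x q) a:]
     = [:a:] * (pcompose q [:a, r:] - [:poly q a:]) + [:r:] * ([:0,1:] * pcompose q [:a, r:])"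
    by (simp add: pcompose_pCons algebra_simps smult_diff_right)
  then show ?case using pCons.IH by (metis dvd_add dvd_mult dvd_triv_left)
qed

text \<open>Write p = T q. Then k annihilates q, and at T = k r the factor T itself brings the k
  that kills the value of q.\<close>

lemma poly_torsion_eval:
  fixes p :: "'a::comm_ring_1 poly"
  assumes "[:k:] * p = 0" "poly p 0 = 0"
  shows "poly p (k * r) = 0"
proof -
  obtain a q where p: "p = pCons a q" by (cases p)
  with assms have a: "a = 0" and "smult k q = 0" by auto
  then have "poly (smult k q) (k * r) = 0" by simp
  then have "r * (k * poly q (k * r)) = 0" by simp
  then show ?thesis by (simp add: p a mult_ac)
qed

section \<open>Dictionary between the blocks of \<phi> and transvections\<close>

lemma smult_one_mat: "(1::'a::comm_ring_1) \<cdot>\<^sub>m A = A"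
  by (rule eq_matI) auto

text \<open>The assumptions from \<open>cd\<close> on are the block entries of \<phi> \<phi>^-1 = I
  and \<phi>^-1 \<phi> = I: c d^t = 1, \<nu> d^t = 0, c \<mu> = 0 and d^t c + \<mu> \<nu> =
  I.\<close>

locale phi_blocks =
  fixes k :: nat and \<phi> :: "'a::comm_ring_1 mat" and c d :: "nat \<Rightarrow> 'a" and nu mu :: "nat \<Rightarrow> nat \<Rightarrow> 'a"
  assumes dim: "dim_row \<phi> = Suc k"
    and c: "i < k \<Longrightarrow> blk_c \<phi> $ i = c i"
    and d: "i < k \<Longrightarrow> blk_d \<phi> $ i = d i"
    and nu: "i < k \<Longrightarrow> j < k \<Longrightarrow> blk_nu \<phi> $$ (i,j) = nu i j"
    and mu: "i < k \<Longrightarrow> j < k \<Longrightarrow> blk_mu \<phi> $$ (i,j) = mu i j"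
    and cd: "dot k c d = 1"
    and nu_d: "i < k \<Longrightarrow> dot k (nu i) d = 0"
    and c_mu: "j < k \<Longrightarrow> dot k c (\<lambda>i. mu i j) = 0"
    and dc_mu_nu: "i < k \<Longrightarrow> j < k \<Longrightarrow> d i * c j + dot k (mu i) (\<lambda>l. nu l j) = (if i = j then 1 else 0)"
begin

definition nu_row :: "(nat \<Rightarrow> 'a) \<Rightarrow> nat \<Rightarrow> 'a" where "nu_row v j = dot k v (\<lambda>i. nu i j)"
definition mu_col :: "(nat \<Rightarrow> 'a) \<Rightarrow> nat \<Rightarrow> 'a" where "mu_col v i = dot k (mu i) v"

lemma alpha_part_eq:
  assumes "v \<in> carrier_vec k" "i < k" "j < k"
  shows "alpha_part \<phi> v $$ (i,j) = d i * nu_row (\<lambda>i. v $ i) j"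
  using assms d dim nu
  by (auto simp: alpha_part_def Let_def nu_row_def dot_def scalar_prod_def lessThan_atLeast0
      blk_nu_def mult.commute intro!: arg_cong2[of _ _ _ _ "(*)"] sum.cong)

lemma beta_part_eq:
  assumes "v \<in> carrier_vec k" "i < k" "j < k"
  shows "beta_part \<phi> v $$ (i,j) = mu_col (\<lambda>i. v $ i) i * c j"
  using assms c dim mu
  by (auto simp: beta_part_def Let_def mu_col_def dot_def scalar_prod_def lessThan_atLeast0
      blk_mu_def intro!: arg_cong2[of _ _ _ _ "(*)"] sum.cong)

lemma part_dims [simp]: "alpha_part \<phi> v \<in> carrier_mat k k" "beta_part \<phi> v \<in> carrier_mat k k"
  by (simp_all add: alpha_part_def beta_part_def dim)

lemma alpha_emat: "v \<in> carrier_vec k \<Longrightarrow> s \<cdot>\<^sub>m 1\<^sub>m k + alpha_part \<phi> v = emat k s d (nu_row (\<lambda>i. v $ i))"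
  using carrier_matD[OF part_dims(1)[of v]] by (intro eq_matI) (auto simp: alpha_part_eq)

lemma beta_emat: "v \<in> carrier_vec k \<Longrightarrow> s \<cdot>\<^sub>m 1\<^sub>m k + beta_part \<phi> v = emat k s (mu_col (\<lambda>i. v $ i)) c"
  using carrier_matD[OF part_dims(2)[of v]] by (intro eq_matI) (auto simp: beta_part_eq)

lemma alpha_gen_emat: "v \<in> carrier_vec k \<Longrightarrow> alpha_gen \<phi> v = emat k 1 d (nu_row (\<lambda>i. v $ i))"
  using alpha_emat[of v 1] by (simp add: alpha_gen_def dim smult_one_mat)

lemma beta_gen_emat: "v \<in> carrier_vec k \<Longrightarrow> beta_gen \<phi> v = emat k 1 (mu_col (\<lambda>i. v $ i)) c"
  using beta_emat[of v 1] by (simp add: beta_gen_def dim smult_one_mat)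

lemma nu_row_d: "dot k (nu_row v) d = 0"
proof -
  have "dot k (nu_row v) d = (\<Sum>i<k. v i * dot k (nu i) d)"
    unfolding nu_row_def dot_def sum_distrib_left sum_distrib_right
    by (subst sum.swap) (simp add: mult.assoc)
  then show ?thesis by (simp add: nu_d)
qed

lemma c_mu_col: "dot k c (mu_col v) = 0"
proof -
  have "dot k c (mu_col v) = (\<Sum>j<k. dot k c (\<lambda>i. mu i j) * v j)"
    unfolding mu_col_def dot_def sum_distrib_left sum_distrib_right
    by (subst sum.swap) (simp add: mult.assoc)
  then show ?thesis by (simp add: c_mu)
qed

text \<open>\<mu> \<nu> = I - d^t c is the identity on the kernel of \<open>c\<close>. With
  \<open>c_mu_col\<close>, the equation c y = 0 therefore describes exactly the columns \<mu>
  v^t.\<close>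

lemma mu_col_onto:
  assumes "dot k c y = 0" "i < k"
  shows "mu_col (\<lambda>l. dot k (nu l) y) i = y i"
proof -
  have "mu_col (\<lambda>l. dot k (nu l) y) i = (\<Sum>j<k. dot k (mu i) (\<lambda>l. nu l j) * y j)"
    unfolding mu_col_def dot_def sum_distrib_left sum_distrib_right
    by (subst sum.swap) (simp add: mult.assoc)
  also have "\<dots> = (\<Sum>j<k. (if i = j then y j else 0) - d i * (c j * y j))"
  proof (rule sum.cong[OF refl])
    fix j assume "j \<in> {..<k}"
    then have e: "dot k (mu i) (\<lambda>l. nu l j) = (if i = j then 1 else 0) - d i * c j"
      using dc_mu_nu[OF assms(2), of j] by (simp only: lessThan_iff eq_diff_eq add.commute)
    show "dot k (mu i) (\<lambda>l. nu l j) * y j = (if i = j then y j else 0) - d i * (c j * y j)"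
      unfolding e by (auto simp: algebra_simps)
  qed
  also have "\<dots> = y i - d i * dot k c y"
    using assms(2) by (simp add: sum_subtractf sum_distrib_left dot_def)
  finally show ?thesis using assms by simp
qed

lemma nu_row_onto:
  assumes "dot k f d = 0" "j < k"
  shows "nu_row (\<lambda>l. dot k f (\<lambda>i. mu i l)) j = f j"
proof -
  have "nu_row (\<lambda>l. dot k f (\<lambda>i. mu i l)) j = (\<Sum>i<k. f i * dot k (mu i) (\<lambda>l. nu l j))"
    unfolding nu_row_def dot_def sum_distrib_left sum_distrib_right
    by (subst sum.swap) (simp add: mult.assoc)
  also have "\<dots> = (\<Sum>i<k. (if i = j then f i else 0) - (f i * d i) * c j)"
  proof (rule sum.cong[OF refl])
    fix i assume "i \<in> {..<k}"
    then have e: "dot k (mu i) (\<lambda>l. nu l j) = (if i = j then 1 else 0) - d i * c j"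
      using dc_mu_nu[OF _ assms(2), of i] by (simp only: lessThan_iff eq_diff_eq add.commute)
    show "f i * dot k (mu i) (\<lambda>l. nu l j) = (if i = j then f i else 0) - (f i * d i) * c j"
      unfolding e by (auto simp: algebra_simps)
  qed
  also have "\<dots> = f j - dot k f d * c j"
    using assms(2) by (simp add: sum_subtractf sum_distrib_right dot_def)
  finally show ?thesis using assms by simp
qed

text \<open>The parameters of a word may lie outside \<open>C\<close>. A homomorphism
  \<open>F\<close> with values in \<open>C\<close> that fixes the blocks moves them into
  \<open>C\<close>; it will be the retraction \<open>truncate_vars t\<close>.\<close>

lemma trvs_E_phi:
  assumes hom: "comm_ring_hom F" and C: "\<And>x. F x \<in> C"
    and fixed: "\<And>i. F (c i) = c i" "\<And>i. F (d i) = d i" "\<And>i j. F (nu i j) = nu i j" "\<And>i j. F (mu i j) = mu i j"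
    and g: "g \<in> trvs k c d 1"
  shows "map_mat F g \<in> E_phi C \<phi>"
proof -
  interpret F: comm_ring_hom F by fact
  show ?thesis using g
  proof (induction rule: trvs.induct)
    case one
    then show ?case using E_one[of \<phi> C] by (simp add: F.map_mat_one dim)
  next
    case (mult g h)
    then show ?case
      by (simp add: F.mat_hom_mult[OF trvs_carrier[OF mult(1)] trvs_carrier[OF mult(2)]] E_mult)
  next
    case (beta y)
    \<comment> \<open>By \<open>mu_col_onto\<close>, \<nu> y is a preimage of \<open>y\<close> under
      \<mu>.\<close>
    define v where "v = vec k (\<lambda>l. F (dot k (nu l) y))"
    have v: "v \<in> vec_over C k" "v \<in> carrier_vec k" by (auto simp: v_def vec_over_def C)
    have "mu_col (\<lambda>i. v $ i) i = F (y i)" if "i < k" for i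
    proof -
      have "F (y i) = F (mu_col (\<lambda>l. dot k (nu l) y) i)" using mu_col_onto[OF beta that] by simp
      also have "\<dots> = mu_col (\<lambda>i. v $ i) i"
        unfolding mu_col_def F.hom_dot by (rule dot_cong) (simp_all add: fixed v_def F.hom_dot)
      finally show ?thesis by simp
    qed
    then have "map_mat F (emat k 1 (\<lambda>i. 1 * y i) c) = beta_gen \<phi> v"
      by (auto simp: F.map_mat_emat F.hom_one beta_gen_emat[OF v(2)] fixed intro!: emat_cong)
    then show ?case using E_beta[of v C \<phi>] v dim by simp
  next
    case (alpha f)
    define v where "v = vec k (\<lambda>l. F (dot k f (\<lambda>i. mu i l)))"
    have v: "v \<in> vec_over C k" "v \<in> carrier_vec k" by (auto simp: v_def vec_over_def C)
    have "nu_row (\<lambda>i. v $ i) j = F (f j)" if "j < k" for j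
    proof -
      have "F (f j) = F (nu_row (\<lambda>l. dot k f (\<lambda>i. mu i l)) j)" using nu_row_onto[OF alpha that] by simp
      also have "\<dots> = nu_row (\<lambda>i. v $ i) j"
        unfolding nu_row_def F.hom_dot by (rule dot_cong) (simp_all add: fixed v_def F.hom_dot)
      finally show ?thesis by simp
    qed
    then have "map_mat F (emat k 1 d (\<lambda>i. 1 * f i)) = alpha_gen \<phi> v"
      by (auto simp: F.map_mat_emat F.hom_one alpha_gen_emat[OF v(2)] fixed intro!: emat_cong)
    then show ?case using E_alpha[of v C \<phi>] v dim by simp
  qed
qed

end

text \<open>\<open>M / s\<close> is a word in generators with denominator \<open>\<rho>\<close>, up to \<open>\<rho>\<close>-torsion.\<close>
definition frac_word :: "nat \<Rightarrow> (nat \<Rightarrow> 'a::comm_ring_1 mpoly) \<Rightarrow> (nat \<Rightarrow> 'a mpoly) \<Rightarrow> 'a \<Rightarrow> 'a \<Rightarrow> 'a mpoly mat \<Rightarrow> bool" where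
  "frac_word k c d \<rho> s M \<longleftrightarrow> (\<exists>gs e e'. (\<forall>g\<in>set gs. gen_ok k c d g) \<and>
     cst \<rho> ^ e \<cdot>\<^sub>m M = (cst s * cst \<rho> ^ e') \<cdot>\<^sub>m gen_prod k c d (cst \<rho>) gs)"

text \<open>Elements of \<open>E_loc\<close> mix many denominators. Asking for a word over every
  multiple of some \<open>\<sigma>\<close> lets them be brought to a common one: for a product of
  two elements, the product of their \<open>\<sigma>\<close> works.\<close>

lemma E_loc_gen_prod:
  fixes \<phi> :: "'a::comm_ring_1 mpoly mat"
  assumes B: "phi_blocks k \<phi> c d nu mu" and m: "maximal_ideal m" and E: "(M, s) \<in> E_loc t m \<phi>"
  shows "M \<in> carrier_mat k k \<and> s \<notin> m \<and> (\<exists>\<sigma>. \<sigma> \<notin> m \<and> (\<forall>\<rho>. \<sigma> dvd \<rho> \<longrightarrow> frac_word k c d \<rho> s M))"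
  using E
proof (induction rule: E_loc.induct)
  interpret B: phi_blocks k \<phi> c d nu mu by (rule B)
  interpret cst: comm_ring_hom cst by (rule cst_hom)
  note dim = B.dim
  {
    case (L_alpha w s)
    then have w: "w \<in> carrier_vec k" by (simp add: vec_over_def dim)
    have "frac_word k c d \<rho> s (cst s \<cdot>\<^sub>m 1\<^sub>m k + alpha_part \<phi> w)" if div: "s dvd \<rho>" for \<rho>
    proof -
      \<comment> \<open>Extending the fraction f / s to l f / \<rho> replaces the denominator
        \<open>s\<close> by \<open>\<rho>\<close>.\<close>
      obtain l where l: "\<rho> = s * l" using div by auto
      let ?f = "B.nu_row (\<lambda>i. w $ i)"
      have "gen_ok k c d (False, \<lambda>i. cst l * ?f i)" by (simp add: gen_ok_def B.nu_row_d)
      moreover have "cst \<rho> ^ 1 \<cdot>\<^sub>m (cst s \<cdot>\<^sub>m 1\<^sub>m k + alpha_part \<phi> w)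
        = (cst s * cst \<rho> ^ 0) \<cdot>\<^sub>m gen_prod k c d (cst \<rho>) [(False, \<lambda>i. cst l * ?f i)]"
        by (intro eq_matI) (auto simp: B.alpha_emat[OF w] gen_mat_def right_mult_one_mat[where nr=k and nc=k] l cst.hom_mult algebra_simps)
      ultimately show ?thesis unfolding frac_word_def by (intro exI[of _ "[(False, \<lambda>i. cst l * ?f i)]"] exI[of _ 1] exI[of _ 0]) auto
    qed
    then show ?case using L_alpha by (auto simp: dim intro: exI[of _ s])
  next
    case (L_beta w s)
    then have w: "w \<in> carrier_vec k" by (simp add: vec_over_def dim)
    have "frac_word k c d \<rho> s (cst s \<cdot>\<^sub>m 1\<^sub>m k + beta_part \<phi> w)" if div: "s dvd \<rho>" for \<rho>
    proof -
      obtain l where l: "\<rho> = s * l" using div by auto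
      let ?f = "B.mu_col (\<lambda>i. w $ i)"
      have "gen_ok k c d (True, \<lambda>i. cst l * ?f i)" by (simp add: gen_ok_def B.c_mu_col)
      moreover have "cst \<rho> ^ 1 \<cdot>\<^sub>m (cst s \<cdot>\<^sub>m 1\<^sub>m k + beta_part \<phi> w)
        = (cst s * cst \<rho> ^ 0) \<cdot>\<^sub>m gen_prod k c d (cst \<rho>) [(True, \<lambda>i. cst l * ?f i)]"
        by (intro eq_matI) (auto simp: B.beta_emat[OF w] gen_mat_def right_mult_one_mat[where nr=k and nc=k] l cst.hom_mult algebra_simps)
      ultimately show ?thesis unfolding frac_word_def by (intro exI[of _ "[(True, \<lambda>i. cst l * ?f i)]"] exI[of _ 1] exI[of _ 0]) auto
    qed
    then show ?case using L_beta by (auto simp: dim intro: exI[of _ s])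
  next
    case L_one
    have "frac_word k c d \<rho> 1 (1\<^sub>m k)" for \<rho>
      unfolding frac_word_def by (rule exI[of _ "[]"], rule exI[of _ 0], rule exI[of _ 0]) auto
    then show ?case using maximal_ideal_one[OF m] by (simp add: dim) blast
  next
    case (L_mult M s N u)
    then obtain \<sigma> \<tau> where st: "\<sigma> \<notin> m" "\<tau> \<notin> m"
      and M: "M \<in> carrier_mat k k" "s \<notin> m" "\<And>\<rho>. \<sigma> dvd \<rho> \<Longrightarrow> frac_word k c d \<rho> s M"
      and N: "N \<in> carrier_mat k k" "u \<notin> m" "\<And>\<rho>. \<tau> dvd \<rho> \<Longrightarrow> frac_word k c d \<rho> u N" by auto
    have "frac_word k c d \<rho> (s * u) (M * N)" if div: "\<sigma> * \<tau> dvd \<rho>" for \<rho>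
    proof -
      obtain gs e e' where 1: "\<forall>g\<in>set gs. gen_ok k c d g"
        "cst \<rho> ^ e \<cdot>\<^sub>m M = (cst s * cst \<rho> ^ e') \<cdot>\<^sub>m gen_prod k c d (cst \<rho>) gs"
        using M(3)[of \<rho>] div dvd_mult_left unfolding frac_word_def by blast
      obtain hs f f' where 2: "\<forall>g\<in>set hs. gen_ok k c d g"
        "cst \<rho> ^ f \<cdot>\<^sub>m N = (cst u * cst \<rho> ^ f') \<cdot>\<^sub>m gen_prod k c d (cst \<rho>) hs"
        using N(3)[of \<rho>] div dvd_mult_right unfolding frac_word_def by blast
      have "cst \<rho> ^ (e + f) \<cdot>\<^sub>m (M * N) = (cst \<rho> ^ e \<cdot>\<^sub>m M) * (cst \<rho> ^ f \<cdot>\<^sub>m N)"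
        using M(1) N(1) by (simp add: smult_sq[of _ k] smult_smult_mat power_add mult_ac)
      also have "\<dots> = (cst (s * u) * cst \<rho> ^ (e' + f')) \<cdot>\<^sub>m gen_prod k c d (cst \<rho>) (gs @ hs)"
        unfolding 1 2 by (simp add: gen_prod_append smult_sq[of _ k] smult_smult_mat power_add cst.hom_mult mult_ac)
      finally show ?thesis using 1(1) 2(1) unfolding frac_word_def
        by (intro exI[of _ "gs @ hs"] exI[of _ "e + f"] exI[of _ "e' + f'"]) auto
    qed
    moreover have "\<sigma> * \<tau> \<notin> m" "s * u \<notin> m" using st M(2) N(2) maximal_ideal_prime[OF m] by blast+
    moreover have "M * N \<in> carrier_mat k k" using M(1) N(1) by auto
    ultimately show ?case by blast
  next
    case (L_inv M s N u)
    then obtain \<sigma> where st: "\<sigma> \<notin> m"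
      and M: "M \<in> carrier_mat k k" "s \<notin> m" "\<And>\<rho>. \<sigma> dvd \<rho> \<Longrightarrow> frac_word k c d \<rho> s M" by auto
    have N: "N \<in> carrier_mat k k" "u \<notin> m" using L_inv by (auto simp: loc_mat_def mat_over_def dim)
    obtain v where v: "v \<notin> m" and v0: "cst v \<cdot>\<^sub>m (cst 1 \<cdot>\<^sub>m (M * N) - cst (s * u) \<cdot>\<^sub>m 1\<^sub>m k) = 0\<^sub>m k k"
      using L_inv(3) M(1) N(1) by (auto simp: loc_eq_def dim)
    have MN: "cst v \<cdot>\<^sub>m (M * N) = cst (v * s * u) \<cdot>\<^sub>m 1\<^sub>m k"
    proof (rule eq_matI, goal_cases)
      case (1 i j)
      then show ?case using arg_cong[OF v0, of "\<lambda>A. A $$ (i,j)"] M N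
        by (simp add: algebra_simps cst.hom_mult)
    qed (use M N in auto)
    \<comment> \<open>The inverse relation holds only after multiplication by \<open>v\<close>, and
      the scalar \<open>s\<close> remains as well. With v s dividing \<open>\<rho>\<close>,
      multiplication by \<open>l\<close> completes both to a power of \<open>\<rho>\<close>.\<close>
    have "frac_word k c d \<rho> u N" if div: "\<sigma> * (v * s) dvd \<rho>" for \<rho>
    proof -
      obtain gs e e' where 1: "\<forall>g\<in>set gs. gen_ok k c d g"
        "cst \<rho> ^ e \<cdot>\<^sub>m M = (cst s * cst \<rho> ^ e') \<cdot>\<^sub>m gen_prod k c d (cst \<rho>) gs"
        using M(3)[of \<rho>] div dvd_mult_left unfolding frac_word_def by blast
      obtain l where l: "\<rho> = v * s * l" using div by (metis dvd_def dvd_mult_right)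
      obtain hs f where 2: "\<forall>g\<in>set hs. gen_ok k c d g"
        "gen_prod k c d (cst \<rho>) hs * gen_prod k c d (cst \<rho>) gs = cst \<rho> ^ f \<cdot>\<^sub>m 1\<^sub>m k"
        using gen_prod_inverse[OF 1(1)] by blast
      let ?E = "gen_prod k c d (cst \<rho>) gs" and ?E' = "gen_prod k c d (cst \<rho>) hs"
      have "(cst v * cst s * cst \<rho> ^ e') \<cdot>\<^sub>m (?E * N) = (cst \<rho> ^ e \<cdot>\<^sub>m M) * (cst v \<cdot>\<^sub>m N)"
        unfolding 1 using N by (simp add: smult_sq[of _ k] smult_smult_mat mult_ac)
      also have "\<dots> = cst \<rho> ^ e \<cdot>\<^sub>m (cst v \<cdot>\<^sub>m (M * N))"
        using M N by (simp add: smult_sq[of _ k] smult_smult_mat mult_ac)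
      also have "\<dots> = (cst v * cst s * cst u * cst \<rho> ^ e) \<cdot>\<^sub>m 1\<^sub>m k"
        unfolding MN by (simp add: smult_smult_mat cst.hom_mult mult_ac)
      finally have *: "(cst v * cst s * cst \<rho> ^ e') \<cdot>\<^sub>m (?E * N) = (cst v * cst s * cst u * cst \<rho> ^ e) \<cdot>\<^sub>m 1\<^sub>m k" .
      have "(cst v * cst s * cst \<rho> ^ (e' + f)) \<cdot>\<^sub>m N = (cst v * cst s * cst \<rho> ^ e') \<cdot>\<^sub>m ((?E' * ?E) * N)"
        unfolding 2 using N by (simp add: smult_sq[of _ k] smult_smult_mat power_add mult_ac left_mult_one_mat[where nr=k and nc=k])
      also have "\<dots> = ?E' * ((cst v * cst s * cst \<rho> ^ e') \<cdot>\<^sub>m (?E * N))"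
        using N by (simp add: smult_sq[of _ k] assoc_sq[of _ k] mult_carrier_mat[where nr=k and n=k and nc=k])
      also have "\<dots> = (cst v * cst s * cst u * cst \<rho> ^ e) \<cdot>\<^sub>m ?E'"
        unfolding * by (simp add: smult_sq[of _ k] right_mult_one_mat[where nr=k and nc=k])
      finally have "cst l \<cdot>\<^sub>m ((cst v * cst s * cst \<rho> ^ (e' + f)) \<cdot>\<^sub>m N) = cst l \<cdot>\<^sub>m ((cst v * cst s * cst u * cst \<rho> ^ e) \<cdot>\<^sub>m ?E')"
        by simp
      moreover have "cst l * (cst v * cst s * cst \<rho> ^ (e' + f)) = cst \<rho> ^ (e' + f + 1)"
        "cst l * (cst v * cst s * cst u * cst \<rho> ^ e) = cst u * cst \<rho> ^ (e + 1)"
        by (simp_all add: l cst.hom_mult mult_ac)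
      ultimately have "cst \<rho> ^ (e' + f + 1) \<cdot>\<^sub>m N = (cst u * cst \<rho> ^ (e + 1)) \<cdot>\<^sub>m ?E'"
        by (simp only: smult_smult_mat)
      then show ?thesis using 2(1) unfolding frac_word_def by blast
    qed
    moreover have "\<sigma> * (v * s) \<notin> m" using st M(2) v maximal_ideal_prime[OF m] by blast
    ultimately show ?case using N by blast
  next
    case (L_eq M s N u)
    then obtain \<sigma> where st: "\<sigma> \<notin> m"
      and M: "M \<in> carrier_mat k k" "s \<notin> m" "\<And>\<rho>. \<sigma> dvd \<rho> \<Longrightarrow> frac_word k c d \<rho> s M" by auto
    have N: "N \<in> carrier_mat k k" "u \<notin> m" using L_eq by (auto simp: loc_mat_def mat_over_def dim)
    obtain v where v: "v \<notin> m" and v0: "cst v \<cdot>\<^sub>m (cst u \<cdot>\<^sub>m M - cst s \<cdot>\<^sub>m N) = 0\<^sub>m k k"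
      using L_eq(3) M(1) N(1) by (auto simp: loc_eq_def dim)
    have MN: "(cst v * cst s) \<cdot>\<^sub>m N = (cst v * cst u) \<cdot>\<^sub>m M"
    proof (rule eq_matI, goal_cases)
      case (1 i j)
      then show ?case using arg_cong[OF v0, of "\<lambda>A. A $$ (i,j)"] M N
        by (simp add: algebra_simps)
    qed (use M N in auto)
    have "frac_word k c d \<rho> u N" if div: "\<sigma> * (v * s) dvd \<rho>" for \<rho>
    proof -
      obtain gs e e' where 1: "\<forall>g\<in>set gs. gen_ok k c d g"
        "cst \<rho> ^ e \<cdot>\<^sub>m M = (cst s * cst \<rho> ^ e') \<cdot>\<^sub>m gen_prod k c d (cst \<rho>) gs"
        using M(3)[of \<rho>] div dvd_mult_left unfolding frac_word_def by blast
      obtain l where l: "\<rho> = v * s * l" using div by (metis dvd_def dvd_mult_right)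
      have "cst \<rho> ^ (e + 1) \<cdot>\<^sub>m N = (cst l * cst \<rho> ^ e) \<cdot>\<^sub>m ((cst v * cst s) \<cdot>\<^sub>m N)"
        by (simp add: smult_smult_mat l cst.hom_mult mult_ac)
      also have "\<dots> = (cst l * cst v * cst u) \<cdot>\<^sub>m (cst \<rho> ^ e \<cdot>\<^sub>m M)"
        unfolding MN by (simp add: smult_smult_mat mult_ac)
      also have "\<dots> = (cst u * cst \<rho> ^ (e' + 1)) \<cdot>\<^sub>m gen_prod k c d (cst \<rho>) gs"
        unfolding 1 by (simp add: smult_smult_mat l cst.hom_mult mult_ac)
      finally show ?thesis using 1(1) unfolding frac_word_def by blast
    qed
    moreover have "\<sigma> * (v * s) \<notin> m" using st M(2) v maximal_ideal_prime[OF m] by blast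
    ultimately show ?case using N by blast
  }
qed

section \<open>Quillen patching\<close>

definition scale_vars :: "'a::comm_ring_1 mpoly \<Rightarrow> 'a mpoly \<Rightarrow> 'a mpoly" where
  "scale_vars x p = poly (homogenize p) x"

lemma scale_vars_hom: "comm_ring_hom (scale_vars x)"
  unfolding scale_vars_def by (rule comm_ring_hom_comp[OF poly_eval_hom homogenize_hom])

lemma pcompose_hom: "comm_ring_hom (\<lambda>p. pcompose p (q :: 'a::comm_ring_1 poly))"
  by unfold_locales (auto simp: pcompose_add pcompose_mult pcompose_pCons one_pCons)

definition quillen_set :: "nat \<Rightarrow> (nat \<Rightarrow> 'a::comm_ring_1) \<Rightarrow> (nat \<Rightarrow> 'a) \<Rightarrow> 'a mpoly mat \<Rightarrow> 'a set" where
  "quillen_set k c d \<theta> = {b. \<forall>a r. \<exists>H \<in> trvs k (\<lambda>i. cst (c i)) (\<lambda>i. cst (d i)) 1.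
     map_mat (scale_vars (cst (a + b * r))) \<theta> = H * map_mat (scale_vars (cst a)) \<theta>}"

text \<open>Since \<open>a\<close> is arbitrary, a step for \<open>y\<close> may start at a + x r,
  which gives sums. Since \<open>r\<close> is arbitrary, it absorbs multiples.\<close>

lemma quillen_set_ideal:
  assumes \<theta>: "\<theta> \<in> carrier_mat k k"
  shows "is_ideal (quillen_set k c d \<theta>)"
  unfolding is_ideal_def
proof (intro conjI ballI allI impI)
  let ?T = "trvs k (\<lambda>i. cst (c i)) (\<lambda>i. cst (d i)) 1"
  have C: "map_mat (scale_vars x) \<theta> \<in> carrier_mat k k" for x using \<theta> by auto
  show "0 \<in> quillen_set k c d \<theta>"
    unfolding quillen_set_def using C by (auto intro!: bexI[of _ "1\<^sub>m k"] trvs.one)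
  fix x y assume x: "x \<in> quillen_set k c d \<theta>" and y: "y \<in> quillen_set k c d \<theta>"
  show "x + y \<in> quillen_set k c d \<theta>"
    unfolding quillen_set_def
  proof (intro CollectI allI)
    fix a r
    obtain H where H: "H \<in> ?T" "map_mat (scale_vars (cst (a + x * r))) \<theta> = H * map_mat (scale_vars (cst a)) \<theta>"
      using x unfolding quillen_set_def by blast
    obtain G where G: "G \<in> ?T"
      "map_mat (scale_vars (cst ((a + x * r) + y * r))) \<theta> = G * map_mat (scale_vars (cst (a + x * r))) \<theta>"
      using y unfolding quillen_set_def by blast
    have "map_mat (scale_vars (cst (a + (x + y) * r))) \<theta> = (G * H) * map_mat (scale_vars (cst a)) \<theta>"
      using G(2) unfolding H(2) using C trvs_carrier[OF G(1)] trvs_carrier[OF H(1)]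
      by (simp add: assoc_sq[of _ k] algebra_simps)
    then show "\<exists>H\<in>?T. map_mat (scale_vars (cst (a + (x + y) * r))) \<theta> = H * map_mat (scale_vars (cst a)) \<theta>"
      using trvs.mult[OF G(1) H(1)] by blast
  qed
next
  fix l x assume x: "x \<in> quillen_set k c d \<theta>"
  have e: "a + l * x * r = a + x * (l * r)" for a r by (simp add: mult_ac)
  show "l * x \<in> quillen_set k c d \<theta>"
    using x unfolding quillen_set_def mem_Collect_eq e by blast
qed

lemma quillen_set_local:
  fixes c d :: "nat \<Rightarrow> 'a::comm_ring_1" and \<theta> :: "'a mpoly mat"
  assumes B: "phi_blocks k \<phi> (\<lambda>i. cst (c i)) (\<lambda>i. cst (d i)) nu mu"
    and cd: "dot k c d = 1" and k: "3 \<le> k"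
    and m: "maximal_ideal m" and \<theta>: "(\<theta>, 1) \<in> E_loc t m \<phi>"
  shows "\<exists>b. b \<notin> m \<and> b \<in> quillen_set k c d \<theta>"
proof -
  interpret cst: comm_ring_hom cst by (rule cst_hom)
  let ?c = "\<lambda>i. cst (c i)" and ?d = "\<lambda>i. cst (d i)"
  obtain \<sigma> where C: "\<theta> \<in> carrier_mat k k" and \<sigma>: "\<sigma> \<notin> m" "\<And>\<rho>. \<sigma> dvd \<rho> \<Longrightarrow> frac_word k ?c ?d \<rho> 1 \<theta>"
    using E_loc_gen_prod[OF B m \<theta>] by auto
  \<comment> \<open>Otherwise c d = 1 would lie in \<open>m\<close>. The entry found gives the
    frame, and multiplying it by \<open>\<sigma>\<close> makes one \<open>\<rho>\<close> serve for
    both frame and word.\<close>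
  have "\<exists>i<k. c i \<notin> m"
  proof (rule ccontr)
    assume "\<not> (\<exists>i<k. c i \<notin> m)"
    then have cm: "c i \<in> m" if "i < k" for i using that by blast
    have I: "is_ideal m" using m by (simp add: maximal_ideal_def)
    have "dot k c d \<in> m"
      unfolding dot_def using I cm
      by (intro ideal_sum[OF I], subst mult.commute) (simp add: is_ideal_def)
    then show False unfolding cd using maximal_ideal_one[OF m] by contradiction
  qed
  then obtain i0 where i0: "i0 < k" "c i0 \<notin> m" by blast
  define \<rho> where "\<rho> = c i0 * \<sigma>"
  have \<rho>: "\<rho> \<notin> m" using i0(2) \<sigma>(1) maximal_ideal_prime[OF m] unfolding \<rho>_def by blast
  obtain gs e e' where gs: "\<And>g. g \<in> set gs \<Longrightarrow> gen_ok k ?c ?d g"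
    and eq: "cst \<rho> ^ e \<cdot>\<^sub>m \<theta> = cst \<rho> ^ e' \<cdot>\<^sub>m gen_prod k ?c ?d (cst \<rho>) gs"
    using \<sigma>(2)[of \<rho>] unfolding frac_word_def \<rho>_def by auto
  \<comment> \<open>The word and \<open>e\<close> are chosen before \<open>a\<close> and
    \<open>r\<close>, so a single power of \<open>\<rho>\<close> works for all of them. Level
    \<rho>^0 = 1 is enough for the result, hence the argument 0.\<close>
  define N where "N = deform_exp (length gs) 0"
  have "\<rho> ^ (N + 1 + e) \<in> quillen_set k c d \<theta>"
    unfolding quillen_set_def
  proof (intro CollectI allI)
    fix a r
    \<comment> \<open>\<open>hom1\<close> is X -> a X, constant in T, and \<open>hom2\<close> is X
      -> (a + \<rho>^(N+1) T) X. They agree modulo \<rho>^(N+1).\<close>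
    define hom1 where "hom1 p = [:scale_vars (cst a) p:]" for p :: "'a mpoly"
    define hom2 where "hom2 p = pcompose (homogenize p) [:cst a, cst \<rho> ^ (N + 1):]" for p :: "'a mpoly"
    interpret h1: comm_ring_hom hom1
      unfolding hom1_def by (rule comm_ring_hom_comp[OF poly_const_hom scale_vars_hom])
    interpret h2: comm_ring_hom hom2
      unfolding hom2_def by (rule comm_ring_hom_comp[OF pcompose_hom homogenize_hom])
    interpret K: comm_ring_hom "\<lambda>p::'a mpoly. [:p:]" by (rule poly_const_hom)
    have ev: "comm_ring_hom (\<lambda>p. poly p x)" for x :: "'a mpoly" by (rule poly_eval_hom)
    have hc: "hom1 (cst x) = [:cst x:]" "hom2 (cst x) = [:cst x:]" for x
      by (simp_all add: hom1_def hom2_def scale_vars_def homogenize_cst)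
    let ?C = "\<lambda>i. [:cst (c i):]" and ?D = "\<lambda>i. [:cst (d i):]" and ?S = "[:cst \<rho>:]"
    have "dot k ?C ?D = [:cst (dot k c d):]" by (simp add: cst.hom_dot K.hom_dot)
    then have CD: "dot k ?C ?D = 1" unfolding cd by simp
    have S: "[:cst (c i0):] * [:cst \<sigma>:] = ?S" by (simp add: \<rho>_def cst.hom_mult)
    obtain p q where fr: "frame k ?C ?D p q ({..<k} - {i0}) ?S"
      using frame_exists[OF CD i0(1) k, of "[:cst \<sigma>:]"] unfolding S by blast
    define ws where "ws = map (\<lambda>(b,w). (b, \<lambda>i. hom1 (w i), \<lambda>i. hom2 (w i))) gs"
    let ?E1 = "map_mat hom1 (gen_prod k ?c ?d (cst \<rho>) gs)" and ?E2 = "map_mat hom2 (gen_prod k ?c ?d (cst \<rho>) gs)"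
    have "\<exists>H \<in> trvs k ?C ?D (?S ^ 0). gen_prod k ?C ?D ?S (map (\<lambda>(b,w,w'). (b,w')) ws)
           = H * gen_prod k ?C ?D ?S (map (\<lambda>(b,w,w'). (b,w)) ws)"
    proof (rule frame.gen_prod_deform[OF fr])
      show "deform_exp (length ws) 0 \<le> N" by (simp add: ws_def N_def)
      fix b w w' assume "(b, w, w') \<in> set ws"
      then obtain v where v: "(b, v) \<in> set gs" "w = (\<lambda>i. hom1 (v i))" "w' = (\<lambda>i. hom2 (v i))"
        by (auto simp: ws_def)
      have "?S ^ (N + 1) dvd w' i - w i" for i
        using poly_dvd_diff_eval[of "cst \<rho> ^ (N + 1)" "homogenize (v i)" "cst a"]
        unfolding v hom1_def hom2_def scale_vars_def poly_const_pow .
      then show "gen_ok k ?C ?D (b, w) \<and> gen_ok k ?C ?D (b, w') \<and> (\<forall>i<k. ?S ^ (N + 1) dvd w' i - w i)"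
        using h1.gen_ok_hom[OF gs[OF v(1)]] h2.gen_ok_hom[OF gs[OF v(1)]] by (simp add: hc v)
    qed
    then obtain H where H: "H \<in> trvs k ?C ?D 1" and E: "?E2 = H * ?E1"
      by (auto simp: h1.gen_prod_hom h2.gen_prod_hom hc ws_def o_def case_prod_unfold)
    define \<theta>1 where "\<theta>1 = map_mat hom1 \<theta>"
    define \<theta>2 where "\<theta>2 = map_mat hom2 \<theta>"
    define \<theta>a where "\<theta>a = map_mat (scale_vars (cst a)) \<theta>"
    have Cs: "\<theta>1 \<in> carrier_mat k k" "\<theta>2 \<in> carrier_mat k k" "\<theta>a \<in> carrier_mat k k"
      using C by (auto simp: \<theta>1_def \<theta>2_def \<theta>a_def)
    have CH: "H \<in> carrier_mat k k" by (rule trvs_carrier[OF H])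
    have e1: "?S ^ e \<cdot>\<^sub>m \<theta>1 = ?S ^ e' \<cdot>\<^sub>m ?E1"
      using arg_cong[OF eq, of "map_mat hom1"] by (simp add: h1.map_mat_smult h1.hom_power hc \<theta>1_def)
    have e2: "?S ^ e \<cdot>\<^sub>m \<theta>2 = ?S ^ e' \<cdot>\<^sub>m ?E2"
      using arg_cong[OF eq, of "map_mat hom2"] by (simp add: h2.map_mat_smult h2.hom_power hc \<theta>2_def)
    have CE: "?E1 \<in> carrier_mat k k" by simp
    have H\<theta>: "?S ^ e \<cdot>\<^sub>m \<theta>2 = H * (?S ^ e \<cdot>\<^sub>m \<theta>1)"
      unfolding e1 e2 E using CH CE by (simp add: smult_sq[of _ k])
    interpret ev0: comm_ring_hom "\<lambda>p. poly p (0 :: 'a mpoly)" by (rule ev)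
    \<comment> \<open>\<open>H0\<close> fixes \<rho>^e \<open>\<theta>a\<close>, but this does not
      make it the identity. Its inverse, taken constant in T, also fixes \<rho>^e
      \<open>\<theta>1\<close>, so multiplying \<open>H\<close> by it normalises the value at T = 0
      and keeps the relation between \<open>\<theta>2\<close> and \<open>\<theta>1\<close>.\<close>
    define H0 where "H0 = map_mat (\<lambda>p. poly p 0) H"
    have H0: "H0 \<in> trvs k ?c ?d 1" using ev0.trvs_hom[OF H] by (simp add: H0_def)
    obtain L where L: "L \<in> trvs k ?c ?d 1" "H0 * L = 1\<^sub>m k" "L * H0 = 1\<^sub>m k"
      using trvs_inverse[OF H0] by blast
    have CL: "L \<in> carrier_mat k k" "H0 \<in> carrier_mat k k" using trvs_carrier L(1) H0 by blast+
    have ev\<theta>1: "map_mat (\<lambda>p. poly p x) \<theta>1 = \<theta>a" for x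
      by (rule eq_matI) (auto simp: \<theta>1_def \<theta>a_def hom1_def)
    have ev\<theta>2: "map_mat (\<lambda>p. poly p x) \<theta>2 = map_mat (scale_vars (cst a + x * cst \<rho> ^ (N + 1))) \<theta>" for x
      by (rule eq_matI) (auto simp: \<theta>2_def hom2_def scale_vars_def poly_pcompose)
    have "map_mat (\<lambda>p. poly p 0) (?S ^ e \<cdot>\<^sub>m \<theta>2) = map_mat (\<lambda>p. poly p 0) (H * (?S ^ e \<cdot>\<^sub>m \<theta>1))"
      using H\<theta> by simp
    then have H0\<theta>: "cst \<rho> ^ e \<cdot>\<^sub>m \<theta>a = H0 * (cst \<rho> ^ e \<cdot>\<^sub>m \<theta>a)"
      using Cs CH
      by (simp add: ev0.map_mat_smult ev0.mat_hom_mult[of _ k k _ k] ev\<theta>1 ev\<theta>2 H0_def \<theta>a_def[symmetric])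
    have "L * (cst \<rho> ^ e \<cdot>\<^sub>m \<theta>a) = L * (H0 * (cst \<rho> ^ e \<cdot>\<^sub>m \<theta>a))" using H0\<theta> by simp
    also have "\<dots> = (L * H0) * (cst \<rho> ^ e \<cdot>\<^sub>m \<theta>a)" using CL Cs by (simp add: assoc_sq[of _ k])
    also have "\<dots> = cst \<rho> ^ e \<cdot>\<^sub>m \<theta>a" unfolding L using Cs by simp
    finally have L\<theta>: "L * (cst \<rho> ^ e \<cdot>\<^sub>m \<theta>a) = cst \<rho> ^ e \<cdot>\<^sub>m \<theta>a" .
    define L' where "L' = map_mat (\<lambda>p. [:p:]) L"
    have L': "L' \<in> trvs k ?C ?D 1" using K.trvs_hom[OF L(1)] by (simp add: L'_def)
    have \<theta>1K: "\<theta>1 = map_mat (\<lambda>p. [:p:]) \<theta>a" by (rule eq_matI) (auto simp: \<theta>1_def \<theta>a_def hom1_def)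
    have CL': "L' \<in> carrier_mat k k" by (rule trvs_carrier[OF L'])
    have L'\<theta>: "L' * (?S ^ e \<cdot>\<^sub>m \<theta>1) = ?S ^ e \<cdot>\<^sub>m \<theta>1"
      using arg_cong[OF L\<theta>, of "map_mat (\<lambda>p. [:p:])"] CL Cs
      by (simp add: K.map_mat_smult K.mat_hom_mult[of _ k k _ k] \<theta>1K L'_def poly_const_pow)
    have HL: "H * L' \<in> trvs k ?C ?D 1" by (rule trvs.mult[OF H L'])
    have main: "?S ^ e \<cdot>\<^sub>m \<theta>2 = ?S ^ e \<cdot>\<^sub>m ((H * L') * \<theta>1)"
    proof -
      have "?S ^ e \<cdot>\<^sub>m \<theta>2 = H * (L' * (?S ^ e \<cdot>\<^sub>m \<theta>1))" unfolding L'\<theta> by (rule H\<theta>)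
      then show ?thesis using CH CL' Cs
        by (simp add: assoc_sq[of _ k] smult_sq[of _ k] mult_carrier_mat[where nr=k and n=k and nc=k])
    qed
    \<comment> \<open>The difference of the two sides is killed by \<rho>^e and vanishes at T = 0,
      so it vanishes at this value of T by \<open>poly_torsion_eval\<close>. The power of
      \<open>\<rho>\<close> becomes N + 1 + e.\<close>
    define x where "x = cst \<rho> ^ e * cst r"
    interpret evx: comm_ring_hom "\<lambda>p. poly p x" by (rule ev)
    have "map_mat (\<lambda>p. poly p 0) ((H * L') * \<theta>1) = (H0 * L) * \<theta>a"
    proof -
      have "map_mat (\<lambda>p. poly p 0) L' = L" by (rule eq_matI) (auto simp: L'_def)
      then show ?thesis using CH CL' Cs
        by (simp add: ev0.mat_hom_mult[of _ k k _ k] ev\<theta>1 mult_carrier_mat[where nr=k and n=k and nc=k] assoc_sq[of _ k] flip: H0_def)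
         (simp add: assoc_sq[of _ k] CL)
    qed
    then have at0: "map_mat (\<lambda>p. poly p 0) ((H * L') * \<theta>1) = map_mat (\<lambda>p. poly p 0) \<theta>2"
      unfolding L using Cs by (simp add: ev\<theta>2 \<theta>a_def)
    have CHL: "(H * L') * \<theta>1 \<in> carrier_mat k k" using CH CL' Cs by auto
    have "map_mat (\<lambda>p. poly p x) \<theta>2 = map_mat (\<lambda>p. poly p x) ((H * L') * \<theta>1)"
    proof (rule eq_matI, goal_cases)
      case (1 i j)
      then have ij: "i < k" "j < k" using CHL by auto
      let ?p = "\<theta>2 $$ (i,j) - ((H * L') * \<theta>1) $$ (i,j)"
      have "poly ?p (cst \<rho> ^ e * cst r) = 0"
      proof (rule poly_torsion_eval)
        show "[:cst \<rho> ^ e:] * ?p = 0"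
          using arg_cong[OF main, of "\<lambda>A. A $$ (i,j)"] ij Cs CHL CH CL'
          by (simp add: right_diff_distrib poly_const_pow smult_diff_right)
        show "poly ?p 0 = 0"
          using arg_cong[OF at0, of "\<lambda>A. A $$ (i,j)"] ij Cs CH CL' by simp
      qed
      then show ?case using ij Cs CH CL' by (simp add: x_def)
    qed (use Cs CH in simp_all)
    also have "\<dots> = map_mat (\<lambda>p. poly p x) (H * L') * \<theta>a"
      using CH CL' Cs by (simp add: evx.mat_hom_mult[of _ k k _ k] ev\<theta>1 mult_carrier_mat[where nr=k and n=k and nc=k])
    finally have "map_mat (scale_vars (cst a + x * cst \<rho> ^ (N + 1))) \<theta> = map_mat (\<lambda>p. poly p x) (H * L') * \<theta>a"
      by (simp only: ev\<theta>2)
    moreover have "cst a + x * cst \<rho> ^ (N + 1) = cst (a + \<rho> ^ (N + 1 + e) * r)"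
      by (simp add: x_def cst.hom_add cst.hom_mult cst.hom_power power_add mult_ac)
    moreover have "map_mat (\<lambda>p. poly p x) (H * L') \<in> trvs k ?c ?d 1"
      using evx.trvs_hom[OF HL] by simp
    ultimately show "\<exists>H\<in>trvs k ?c ?d 1. map_mat (scale_vars (cst (a + \<rho> ^ (N + 1 + e) * r))) \<theta>
       = H * map_mat (scale_vars (cst a)) \<theta>" unfolding \<theta>a_def by metis
  qed
  then show ?thesis using maximal_ideal_power[OF m \<rho>] by blast
qed

lemma trvs_local_global:
  fixes c d :: "nat \<Rightarrow> 'a::comm_ring_1" and \<theta> :: "'a mpoly mat"
  assumes B: "phi_blocks k \<phi> (\<lambda>i. cst (c i)) (\<lambda>i. cst (d i)) nu mu"
    and cd: "dot k c d = 1" and k: "3 \<le> k" and \<theta>: "\<theta> \<in> carrier_mat k k" "eval_zero \<theta> = 1\<^sub>m k"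
    and loc: "\<And>m. maximal_ideal m \<Longrightarrow> (\<theta>, 1) \<in> E_loc t m \<phi>"
  shows "\<theta> \<in> trvs k (\<lambda>i. cst (c i)) (\<lambda>i. cst (d i)) 1"
proof -
  interpret cst: comm_ring_hom cst by (rule cst_hom)
  let ?J = "quillen_set k c d \<theta>"
  have "?J = UNIV"
  proof (rule ccontr)
    assume "?J \<noteq> UNIV"
    then obtain m where "maximal_ideal m" "?J \<subseteq> m"
      using maximal_ideal_exists[OF quillen_set_ideal[OF \<theta>(1)]] by blast
    then show False using quillen_set_local[OF B cd k _ loc] by blast
  qed
  then have "1 \<in> ?J" by simp
  then have "\<exists>H \<in> trvs k (\<lambda>i. cst (c i)) (\<lambda>i. cst (d i)) 1.
     map_mat (scale_vars (cst (0 + 1 * 1))) \<theta> = H * map_mat (scale_vars (cst 0)) \<theta>"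
    unfolding quillen_set_def by blast
  then obtain H where H: "H \<in> trvs k (\<lambda>i. cst (c i)) (\<lambda>i. cst (d i)) 1"
     "map_mat (scale_vars 1) \<theta> = H * map_mat (scale_vars 0) \<theta>"
    by auto
  have "map_mat (scale_vars 1) \<theta> = \<theta>"
    by (rule eq_matI) (auto simp: scale_vars_def poly_homogenize_1)
  moreover have "map_mat (scale_vars 0) \<theta> = 1\<^sub>m k"
  proof (rule eq_matI, goal_cases)
    case (1 i j)
    then have "Poly_Mapping.lookup (\<theta> $$ (i,j)) 0 = (if i = j then 1 else 0)"
      using arg_cong[OF \<theta>(2), of "\<lambda>A. A $$ (i,j)"] \<theta>(1) by (auto simp: eval_zero_def)
    then show ?case using 1 \<theta>(1) by (auto simp: scale_vars_def poly_homogenize_0)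
  qed (use \<theta> in auto)
  ultimately show ?thesis using H trvs_carrier[OF H(1)] by simp
qed

section \<open>The blocks of an alternating matrix and its inverse\<close>

text \<open>Two-sided inverses are unique, so the choice in \<open>mat_inverse\<close> is
  determined. This identifies the inverse over the polynomial ring with the image of the inverse
  over the base ring.\<close>

lemma mat_inverse_eqI:
  assumes "\<phi> \<in> carrier_mat m m" "B \<in> carrier_mat m m" "\<phi> * B = 1\<^sub>m m" "B * \<phi> = 1\<^sub>m m"
  shows "mat_inverse \<phi> = B"
proof -
  let ?X = "mat_inverse \<phi>"
  have m: "dim_row \<phi> = m" using assms(1) by simp
  have "\<exists>X. X \<in> carrier_mat m m \<and> \<phi> * X = 1\<^sub>m m \<and> X * \<phi> = 1\<^sub>m m" using assms by blast
  from someI_ex[OF this] have X: "?X \<in> carrier_mat m m" "?X * \<phi> = 1\<^sub>m m"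
    unfolding mat_inverse_def m by blast+
  have "?X = ?X * (\<phi> * B)" unfolding assms(3) using X(1) by simp
  also have "\<dots> = (?X * \<phi>) * B" by (rule assoc_sq[symmetric, OF X(1) assms(1,2)])
  also have "\<dots> = B" using X assms(2) by simp
  finally show ?thesis .
qed

text \<open>For \<phi> = \<nu> - \<nu>^t the sum is a difference of two double sums that agree after
  exchanging the indices; 2 is never divided out.\<close>

lemma alternating_quadratic_zero:
  assumes "\<phi> \<in> carrier_mat m m" "alternating_mat \<phi>"
  shows "(\<Sum>i<m. \<Sum>j<m. x i * \<phi> $$ (i,j) * x j) = (0::'a::comm_ring_1)"
proof -
  obtain \<nu> where \<nu>: "\<nu> \<in> carrier_mat m m" "\<phi> = \<nu> - transpose_mat \<nu>"
    using assms unfolding alternating_mat_def by auto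
  have "(\<Sum>i<m. \<Sum>j<m. x i * \<phi> $$ (i,j) * x j)
     = (\<Sum>i<m. \<Sum>j<m. x i * \<nu> $$ (i,j) * x j - x j * \<nu> $$ (j,i) * x i)"
    using \<nu> by (intro sum.cong refl) (auto simp: algebra_simps)
  also have "\<dots> = (\<Sum>i<m. \<Sum>j<m. x i * \<nu> $$ (i,j) * x j) - (\<Sum>i<m. \<Sum>j<m. x j * \<nu> $$ (j,i) * x i)"
    by (simp add: sum_subtractf)
  also have "(\<Sum>i<m. \<Sum>j<m. x j * \<nu> $$ (j,i) * x i) = (\<Sum>i<m. \<Sum>j<m. x i * \<nu> $$ (i,j) * x j)"
    by (rule sum.swap)
  finally show ?thesis by simp
qed

text \<open>Skew-symmetry of \<open>B\<close> alone would leave 2 B_ii = 0. From B = B \<phi> B and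
  B^t = -B, the entry B_ii is minus the form \<phi> evaluated at row i of \<open>B\<close>, which is
  0.\<close>

lemma alternating_inverse:
  fixes \<phi> :: "'a::comm_ring_1 mat"
  assumes \<phi>: "\<phi> \<in> carrier_mat m m" and alt: "alternating_mat \<phi>"
    and B: "B \<in> carrier_mat m m" "\<phi> * B = 1\<^sub>m m" "B * \<phi> = 1\<^sub>m m" and ij: "i < m" "j < m"
  shows "B $$ (j,i) = - B $$ (i,j)" "B $$ (i,i) = 0"
proof -
  have T: "transpose_mat B \<in> carrier_mat m m" using B(1) by simp
  have "1\<^sub>m m = transpose_mat (\<phi> * B)" unfolding B by simp
  also have "\<dots> = - (transpose_mat B * \<phi>)"
    using T \<phi> by (simp add: transpose_mult[OF \<phi> B(1)] alternating_skew[OF \<phi> alt])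
  finally have 1: "1\<^sub>m m = - (transpose_mat B * \<phi>)" .
  have "transpose_mat B = transpose_mat B * (\<phi> * B)" unfolding B using T by simp
  also have "\<dots> = (transpose_mat B * \<phi>) * B" using T \<phi> B by (simp add: assoc_sq[of _ m])
  also have "\<dots> = - (- (transpose_mat B * \<phi>) * B)" using T \<phi> B by simp
  also have "\<dots> = - B" unfolding 1[symmetric] using B by simp
  finally have skew: "transpose_mat B = - B" .
  have sk: "B $$ (j,i) = - B $$ (i,j)" if "i < m" "j < m" for i j
    using arg_cong[OF skew, of "\<lambda>M. M $$ (i,j)"] that B(1) by simp
  then show "B $$ (j,i) = - B $$ (i,j)" using ij by blast
  have "B = B * (\<phi> * B)" unfolding B using B(1) by simp
  then have "B $$ (i,i) = (B * (\<phi> * B)) $$ (i,i)" by simp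
  also have "\<dots> = (\<Sum>a<m. B $$ (i,a) * (\<Sum>b<m. \<phi> $$ (a,b) * B $$ (b,i)))"
    using \<phi> B(1) ij by (simp add: scalar_prod_def lessThan_atLeast0)
  also have "\<dots> = (\<Sum>a<m. \<Sum>b<m. - (B $$ (i,a) * \<phi> $$ (a,b) * B $$ (i,b)))"
    unfolding sum_distrib_left using ij by (intro sum.cong refl) (subst sk[of i], auto simp: mult_ac)
  also have "\<dots> = 0"
    using alternating_quadratic_zero[OF \<phi> alt, of "\<lambda>a. B $$ (i,a)"] by (simp add: sum_negf)
  finally show "B $$ (i,i) = 0" .
qed

text \<open>The entries of \<phi> B = I in the first row or column, and the lower right block of B
  \<phi> = I, simplified by the zero corners of both matrices and the skew-symmetry of
  \<open>B\<close>.\<close>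

lemma block_relations:
  fixes \<phi> :: "'a::comm_ring_1 mat"
  assumes \<phi>: "\<phi> \<in> carrier_mat (Suc k) (Suc k)" and alt: "alternating_mat \<phi>"
    and B: "B \<in> carrier_mat (Suc k) (Suc k)" "\<phi> * B = 1\<^sub>m (Suc k)" "B * \<phi> = 1\<^sub>m (Suc k)"
  defines "c \<equiv> \<lambda>i. - \<phi> $$ (0, Suc i)" and "d \<equiv> \<lambda>i. B $$ (0, Suc i)"
    and "nu \<equiv> \<lambda>i j. \<phi> $$ (Suc i, Suc j)" and "mu \<equiv> \<lambda>i j. B $$ (Suc i, Suc j)"
  shows "dot k c d = 1"
    and "i < k \<Longrightarrow> dot k (nu i) d = 0"
    and "j < k \<Longrightarrow> dot k c (\<lambda>i. mu i j) = 0"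
    and "i < k \<Longrightarrow> j < k \<Longrightarrow> d i * c j + dot k (mu i) (\<lambda>l. nu l j) = (if i = j then 1 else 0)"
proof -
  have prod: "M $$ (i,0) * N $$ (0,j) + (\<Sum>l<k. M $$ (i, Suc l) * N $$ (Suc l, j)) = (if i = j then 1 else 0)"
    if "M \<in> carrier_mat (Suc k) (Suc k)" "N \<in> carrier_mat (Suc k) (Suc k)" "M * N = 1\<^sub>m (Suc k)"
      "i < Suc k" "j < Suc k" for M N :: "'a mat" and i j
  proof -
    have "(M * N) $$ (i,j) = (\<Sum>l<Suc k. M $$ (i,l) * N $$ (l,j))"
      using that(1,2,4,5) by (simp add: scalar_prod_def lessThan_atLeast0)
    also have "\<dots> = M $$ (i,0) * N $$ (0,j) + (\<Sum>l<k. M $$ (i, Suc l) * N $$ (Suc l, j))"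
      by (rule sum.lessThan_Suc_shift)
    finally show ?thesis using that(3-5) by simp
  qed
  have \<phi>0: "\<phi> $$ (0,0) = 0" using alternating_on_diag[OF alternating_mat_on[OF \<phi> alt], of 0] by simp
  have B0: "B $$ (0,0) = 0" by (rule alternating_inverse(2)[OF \<phi> alt B, where j=0]) simp_all
  have Bs: "B $$ (Suc l, 0) = - B $$ (0, Suc l)" if "l < k" for l
    by (rule alternating_inverse(1)[OF \<phi> alt B]) (use that in auto)
  show "dot k c d = 1"
    using prod[OF \<phi> B(1,2), of 0 0] by (simp add: \<phi>0 Bs dot_def c_def d_def sum_negf)
  show "dot k (nu i) d = 0" if "i < k"
    using prod[OF \<phi> B(1,2), of "Suc i" 0] that by (simp add: B0 Bs dot_def nu_def d_def sum_negf)
  show "dot k c (\<lambda>i. mu i j) = 0" if "j < k"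
    using prod[OF \<phi> B(1,2), of 0 "Suc j"] that by (simp add: \<phi>0 dot_def c_def mu_def sum_negf)
  show "d i * c j + dot k (mu i) (\<lambda>l. nu l j) = (if i = j then 1 else 0)" if "i < k" "j < k"
    using prod[OF B(1) \<phi> B(3), of "Suc i" "Suc j"] that by (simp add: Bs dot_def c_def d_def mu_def nu_def)
qed

lemma phi_blocks_cst:
  fixes \<phi> :: "'a::comm_ring_1 mat"
  assumes \<phi>: "\<phi> \<in> carrier_mat (Suc k) (Suc k)" and alt: "alternating_mat \<phi>"
    and B: "B \<in> carrier_mat (Suc k) (Suc k)" "\<phi> * B = 1\<^sub>m (Suc k)" "B * \<phi> = 1\<^sub>m (Suc k)"
  shows "phi_blocks k (map_mat cst \<phi>) (\<lambda>i. cst (- \<phi> $$ (0, Suc i))) (\<lambda>i. cst (B $$ (0, Suc i)))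
    (\<lambda>i j. cst (\<phi> $$ (Suc i, Suc j))) (\<lambda>i j. cst (B $$ (Suc i, Suc j)))"
proof -
  interpret cst: comm_ring_hom cst by (rule cst_hom)
  note R = block_relations[OF \<phi> alt B]
  have inv: "mat_inverse (map_mat cst \<phi>) = map_mat cst B"
    using \<phi> B by (intro mat_inverse_eqI[of _ "Suc k"])
      (auto simp: cst.map_mat_one simp flip: cst.mat_hom_mult[of _ "Suc k" "Suc k" _ "Suc k"])
  show ?thesis
  proof
    show "dot k (\<lambda>i. cst (- \<phi> $$ (0, Suc i))) (\<lambda>i. cst (B $$ (0, Suc i))) = 1"
      unfolding cst.hom_dot[symmetric] R(1) by simp
    show "dot k (\<lambda>j. cst (\<phi> $$ (Suc i, Suc j))) (\<lambda>i. cst (B $$ (0, Suc i))) = 0" if "i < k" for i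
      unfolding cst.hom_dot[symmetric] R(2)[OF that] by simp
    show "dot k (\<lambda>i. cst (- \<phi> $$ (0, Suc i))) (\<lambda>i. cst (B $$ (Suc i, Suc j))) = 0" if "j < k" for j
      unfolding cst.hom_dot[symmetric] R(3)[OF that] by simp
    show "cst (B $$ (0, Suc i)) * cst (- \<phi> $$ (0, Suc j)) +
        dot k (\<lambda>j. cst (B $$ (Suc i, Suc j))) (\<lambda>l. cst (\<phi> $$ (Suc l, Suc j))) = (if i = j then 1 else 0)"
      if "i < k" "j < k" for i j
      unfolding cst.hom_dot[symmetric] cst.hom_mult[symmetric] cst.hom_add[symmetric] R(4)[OF that] by simp
  qed (use \<phi> B in \<open>auto simp: blk_c_def blk_d_def blk_nu_def blk_mu_def inv cst.hom_uminus\<close>)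
qed

theorem theorem4p7:
  fixes \<phi> :: "'a::comm_ring_1 mat" and \<theta> :: "'a mpoly mat" and n t :: nat
  assumes "n \<ge> 2" and "t \<ge> 1"
    and "\<phi> \<in> carrier_mat (2*n) (2*n)" and "alternating_mat \<phi>" and "pfaffian \<phi> = 1"
    and "\<theta> \<in> mat_over (polys_in t) (2*n - 1)" and "det \<theta> = 1"
    and "eval_zero \<theta> = 1\<^sub>m (2*n - 1)"
    and "\<forall>m. maximal_ideal m \<longrightarrow> (\<theta>, 1) \<in> E_loc t m (map_mat cst \<phi>)"
  shows "\<theta> \<in> E_phi (polys_in t) (map_mat cst \<phi>)"
proof -
  define k where "k = 2*n - 1"
  have k: "2*n = Suc k" "3 \<le> k" using assms(1) by (auto simp: k_def)
  obtain B where B: "B \<in> carrier_mat (Suc k) (Suc k)" "\<phi> * B = 1\<^sub>m (Suc k)" "B * \<phi> = 1\<^sub>m (Suc k)"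
    using pfaffian_one_invertible[OF assms(3-5)] unfolding k(1) by blast
  have \<phi>: "\<phi> \<in> carrier_mat (Suc k) (Suc k)" using assms(3) unfolding k(1) .
  have \<theta>: "\<theta> \<in> carrier_mat k k" "\<And>i j. i < k \<Longrightarrow> j < k \<Longrightarrow> \<theta> $$ (i,j) \<in> polys_in t"
    using assms(6) by (auto simp: mat_over_def k_def)
  note blocks = phi_blocks_cst[OF \<phi> assms(4) B]
  have "\<theta> \<in> trvs k (\<lambda>i. cst (- \<phi> $$ (0, Suc i))) (\<lambda>i. cst (B $$ (0, Suc i))) 1"
    by (rule trvs_local_global[OF blocks block_relations(1)[OF \<phi> assms(4) B] k(2) \<theta>(1)])
       (use assms(8,9) in \<open>auto simp: k_def\<close>)
  \<comment> \<open>The word provided by patching may involve variables beyond the first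
    \<open>t\<close>; the retraction removes them and fixes \<open>\<theta>\<close>.\<close>
  then have "map_mat (truncate_vars t) \<theta> \<in> E_phi (polys_in t) (map_mat cst \<phi>)"
    by (rule phi_blocks.trvs_E_phi[OF blocks truncate_vars_hom truncate_vars_in, rotated -1])
       (simp_all add: truncate_vars_cst)
  moreover have "map_mat (truncate_vars t) \<theta> = \<theta>"
    by (rule eq_matI) (use \<theta> in \<open>auto simp: truncate_vars_id\<close>)
  ultimately show ?thesis by simp
qed

end
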